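(* Let $X = \{x_1,\dots,x_n\}$ and $Y = \{y_1,\dots,y_m\}$ be two disjoint finite sets of variables, put $Z = X\cup Y$ and $F = \mathbb{K}\langle Z\rangle$. Let $L\subset Y^+$ be an unambiguous context-free language and, for some $k\ge 1$, let $R_0\subset X^*$ and $R_1, R'_1, \ldots, R_k, R'_k \subset X^+$ be regular languages such that their disjoint union $$L'_1 = R_0 \cup R_1 \cup R'_1 \cup \cdots \cup R_k \cup R'_k$$ is a minimal monomial basis (i.e. an antichain with respect to the subword relation). Consider the monomial algebra $A = F/I$, where the monomial ideal $I$ is generated by $$L_1 = R_0 \cup R_1 L R'_1 \cup \cdots\cup R_k L R'_k,$$ and assume that all words of $L_1$ have length at least $2$. Then $A$ is homologically unambiguous.
   Context: $\mathbb{K}$ is any field. For an alphabet $Z$, $Z^*$ is the free monoid of words on $Z$, $|w|$ is the length of a word $w$, $Z^+=\{w\in Z^*\mid |w|\ge 1\}$, and the product of languages is $MM'=\{ww'\mid w\in M,w'\in M'\}$. $F=\mathbb{K}\langle Z\rangle$ is the free associative algebra. A monomial ideal is a two-sided ideal $I$ of $F$ generated by words; it has a unique minimal monomial basis $L_1(A)$, i.e. a generating set of words which is an antichain (no word of it is a subword of a different word of it). A monomial algebra is $A=F/I$ with $I$ a monomial ideal; $N(I)=Z^*\setminus I$ is its set of normal words. Chain languages $L_i=L_i(A)$ (when all words of $L_1(A)$ have length at least $2$): $L_0=Z$, and $L_1$ is the minimal monomial basis of $I$. Each $w\in L_1$ is written $w=st$ with $s\in L_0$ its first letter (its prefix $0$-chain)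 and $t\in N(I)$ (its tail). Inductively, for $i\ge 1$, suppose each $w\in L_i$ is written $w=st$ with prefix $(i-1)$-chain $s\in L_{i-1}$ and tail $t\in N(I)$. Let $\bar L'_{i+1}$ be the set of pairs $(w,u)$ with $w=st\in L_i$, $u\in Z^*$, such that there exist $w'\in L_1$ and $v\in Z^*$ with $wu=vw'$, $|u|<|w'|$, $|v|\ge |s|$. Let $\bar L_{i+1}$ be the set of those $(w,u)\in\bar L'_{i+1}$ for which there is no $(w,u_1)\in\bar L'_{i+1}$ with $u_1$ a proper prefix of $u$. Then $L_{i+1}=\{wu\mid (w,u)\in\bar L_{i+1}\}$, where $wu$ has prefix $i$-chain $w$ and tail $u$. (These languages give the minimal graded free right $A$-module resolution $\cdots\to\mathbb{K}L_1\otimes A\to\mathbb{K}L_0\otimes A\to A\to\mathbb{K}\to 0$, so that $\mathrm{Tor}_i^A(\mathbb{K},\mathbb{K})\cong\mathbb{K}L_{i-1}$ as $Z^*$-graded vector spaces, with $L_{-1}=\{1\}$.) A context-free grammar $G$ is unambiguous if every word of the language it generates has a unique leftmost derivation from the start variable; a language is an unambiguous context-free language if it is generated by some unambiguous context-free grammar. A monomial algebra $A$ with all words of $L_1(A)$ of length at least $2$ is called homologically unambiguous if all chain languages $L_i(A)$ $(i\ge 1)$ are unambiguous context-free languages. *)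

theory Defs
  imports "HOL-Library.Poly_Mapping" "HOL-Library.Sublist" "HOL-Algebra.QuotRing"
begin

section \<open>Words and languages\<close>

text \<open>\<open>lists Z\<close> is the free monoid on the alphabet \<open>Z\<close>; \<^const>\<open>sublist\<close> is the relation
  of being a (contiguous) subword.\<close>

definition lang_prod :: "'a list set \<Rightarrow> 'a list set \<Rightarrow> 'a list set" (infixr "\<cdot>\<cdot>" 75) where
  "M \<cdot>\<cdot> M' = {w @ w' | w w'. w \<in> M \<and> w' \<in> M'}"

definition antichain :: "'a list set \<Rightarrow> bool" where
  "antichain M \<longleftrightarrow> (\<forall>u\<in>M. \<forall>v\<in>M. sublist u v \<longrightarrow> u = v)"

text \<open>Recognition by a finite deterministic automaton over the alphabet \<open>Z\<close>. States are natural
  numbers, which costs no generality because the set \<open>Q\<close> of states is finite.\<close>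

definition regular_lang :: "'a set \<Rightarrow> 'a list set \<Rightarrow> bool" where
  "regular_lang Z M \<longleftrightarrow>
    (\<exists>(Q :: nat set) q0 \<delta> Acc. finite Q \<and> q0 \<in> Q \<and> (\<forall>q\<in>Q. \<forall>a\<in>Z. \<delta> q a \<in> Q) \<and> Acc \<subseteq> Q \<and>
       M = {w \<in> lists Z. foldl \<delta> q0 w \<in> Acc})"


section \<open>Unambiguous context-free languages\<close>

datatype ('n, 't) sym = Nt 'n | Tm 't

text \<open>The terminals and variables of a grammar are those occurring in its finitely many productions,
  together with the start variable.\<close>

record ('n, 't) cfg =
  prods :: "('n \<times> ('n, 't) sym list) set"
  start :: 'n

definition derives1 :: "('n, 't) cfg \<Rightarrow> ('n, 't) sym list \<Rightarrow> ('n, 't) sym list \<Rightarrow> bool" where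
  "derives1 G \<alpha> \<beta> \<longleftrightarrow>
    (\<exists>u A v \<gamma>. (A, \<gamma>) \<in> prods G \<and> \<alpha> = u @ Nt A # v \<and> \<beta> = u @ \<gamma> @ v)"

definition left_derives1 :: "('n, 't) cfg \<Rightarrow> ('n, 't) sym list \<Rightarrow> ('n, 't) sym list \<Rightarrow> bool" where
  "left_derives1 G \<alpha> \<beta> \<longleftrightarrow>
    (\<exists>u A v \<gamma>. (A, \<gamma>) \<in> prods G \<and> \<alpha> = map Tm u @ Nt A # v \<and> \<beta> = map Tm u @ \<gamma> @ v)"

definition cfg_lang :: "('n, 't) cfg \<Rightarrow> 't list set" where
  "cfg_lang G = {w. (derives1 G)\<^sup>*\<^sup>* [Nt (start G)] (map Tm w)}"

text \<open>A leftmost derivation is recorded as its list of sentential forms. Two consecutive forms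
  determine the production applied, so this is the same as recording the productions.\<close>

definition leftmost_derivation :: "('n, 't) cfg \<Rightarrow> 't list \<Rightarrow> ('n, 't) sym list list \<Rightarrow> bool" where
  "leftmost_derivation G w d \<longleftrightarrow>
    d \<noteq> [] \<and> hd d = [Nt (start G)] \<and> last d = map Tm w \<and>
    (\<forall>j. Suc j < length d \<longrightarrow> left_derives1 G (d ! j) (d ! Suc j))"

definition unambiguous_cfg :: "('n, 't) cfg \<Rightarrow> bool" where
  "unambiguous_cfg G \<longleftrightarrow> (\<forall>w \<in> cfg_lang G. \<exists>!d. leftmost_derivation G w d)"

definition unambiguous_cfl :: "'t list set \<Rightarrow> bool" where
  "unambiguous_cfl M \<longleftrightarrow>
    (\<exists>G :: (nat, 't) cfg. finite (prods G) \<and> unambiguous_cfg G \<and> cfg_lang G = M)"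


section \<open>Free algebras and monomial algebras\<close>

text \<open>Lists form a monoid under concatenation, written additively because this is what the
  (convolution) product on \<^typ>\<open>'b \<Rightarrow>\<^sub>0 'k\<close> expects of the exponents \<^typ>\<open>'b\<close>.\<close>

instantiation list :: (type) monoid_add
begin

definition zero_list_def: "0 = ([] :: 'a list)"
definition plus_list_def: "u + v = (u @ v :: 'a list)"

instance by standard (simp_all add: zero_list_def plus_list_def)

end

text \<open>Since scalars are elements of the ring \<open>free_algebra Z\<close>, its two-sided ring ideals are its
  two-sided algebra ideals.\<close>

definition free_algebra :: "'a set \<Rightarrow> ('a list \<Rightarrow>\<^sub>0 'k::field) ring" where
  "free_algebra Z = \<lparr>carrier = {p. Poly_Mapping.keys p \<subseteq> lists Z}, mult = (*), one = 1, zero = 0, add = (+)\<rparr>"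

definition word_mon :: "'a list \<Rightarrow> ('a list \<Rightarrow>\<^sub>0 'k::field)" where
  "word_mon w = Poly_Mapping.single w 1"

definition monomial_ideal_gen :: "'a set \<Rightarrow> 'a list set \<Rightarrow> ('a list \<Rightarrow>\<^sub>0 'k::field) set" where
  "monomial_ideal_gen Z M = Idl\<^bsub>free_algebra Z\<^esub> (word_mon ` M)"

definition monomial_ideal :: "'a set \<Rightarrow> ('a list \<Rightarrow>\<^sub>0 'k::field) set \<Rightarrow> bool" where
  "monomial_ideal Z I \<longleftrightarrow> (\<exists>M \<subseteq> lists Z. I = monomial_ideal_gen Z M)"

definition min_basis :: "'a set \<Rightarrow> ('a list \<Rightarrow>\<^sub>0 'k::field) set \<Rightarrow> 'a list set" where
  "min_basis Z I = (THE M. M \<subseteq> lists Z \<and> antichain M \<and> monomial_ideal_gen Z M = I)"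


section \<open>Chain languages\<close>

text \<open>Chains are represented together with their decomposition, as pairs \<open>(s, t)\<close> of a prefix chain
  \<open>s\<close> and a tail \<open>t\<close>. Given the decomposed \<open>i\<close>-chains \<open>C\<close> (\<open>i \<ge> 1\<close>), \<open>chain_exts L1 C\<close> is the set of
  pairs usually written \<open>L'\<close> with index \<open>i + 1\<close> and a bar, and \<open>minimal_exts\<close> keeps the pairs
  \<open>(w, u)\<close> with \<open>u\<close> minimal for the prefix order.\<close>

definition chain_exts ::
  "'a list set \<Rightarrow> ('a list \<times> 'a list) set \<Rightarrow> ('a list \<times> 'a list) set" where
  "chain_exts L1 C = {(w, u). \<exists>s t. (s, t) \<in> C \<and> w = s @ t \<and>
     (\<exists>w' \<in> L1. \<exists>v. w @ u = v @ w' \<and> length u < length w' \<and> length s \<le> length v)}"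

definition minimal_exts :: "('a list \<times> 'a list) set \<Rightarrow> ('a list \<times> 'a list) set" where
  "minimal_exts E = {(w, u) \<in> E. \<not> (\<exists>u1. (w, u1) \<in> E \<and> strict_prefix u1 u)}"

text \<open>Pitfall: the index is shifted, \<open>chain_pairs L1 n\<close> consists of the decomposed \<open>(n + 1)\<close>-chains.
  When \<open>L1\<close> is an antichain all tails are automatically normal words, being proper suffixes of words
  of \<open>L1\<close>.\<close>

primrec chain_pairs :: "'a list set \<Rightarrow> nat \<Rightarrow> ('a list \<times> 'a list) set" where
  "chain_pairs L1 0 = {([a], t) | a t. a # t \<in> L1}"
| "chain_pairs L1 (Suc n) = minimal_exts (chain_exts L1 (chain_pairs L1 n))"

definition chain_lang :: "'a set \<Rightarrow> ('a list \<Rightarrow>\<^sub>0 'k::field) set \<Rightarrow> nat \<Rightarrow> 'a list set" where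
  "chain_lang Z I i = (case i of
     0 \<Rightarrow> {[z] | z. z \<in> Z}
   | Suc n \<Rightarrow> {s @ t | s t. (s, t) \<in> chain_pairs (min_basis Z I) n})"

text \<open>A monomial algebra comes with its presentation \<open>A = F / I\<close>. The ideal is determined by \<open>A\<close>,
  as it is the zero element of the quotient ring.\<close>

definition homologically_unambiguous :: "'a set \<Rightarrow> ('a list \<Rightarrow>\<^sub>0 'k::field) set ring \<Rightarrow> bool" where
  "homologically_unambiguous Z A \<longleftrightarrow>
    (\<exists>I. monomial_ideal Z I \<and> A = free_algebra Z Quot I \<and>
       (\<forall>w \<in> min_basis Z I. 2 \<le> length w) \<and>
       (\<forall>i\<ge>1. unambiguous_cfl (chain_lang Z I i)))"

end

theory Submission
  imports Defs
begin

text \<open>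
  The idea is to separate the regular part of the problem from the language \<open>L\<close>. Call a maximal run of
  letters from \<open>Y\<close> in a word a block. Let \<open>M\<close> arise from \<open>L1\<close> by allowing every nonempty word over
  \<open>Y\<close> where \<open>L1\<close> has a word of \<open>L\<close>. The language \<open>M\<close> is regular, it is an antichain just as \<open>L1\<close> is, and
  \<open>L1\<close> consists of the words of \<open>M\<close> whose blocks lie in \<open>L\<close>.

  The chains of \<open>L1\<close> are exactly the chains of \<open>M\<close> all of whose blocks lie in \<open>L\<close>
  (\<open>chain_words_Int_blocks\<close>). The reason is that every word of \<open>M\<close> begins and ends with a letter of
  \<open>X\<close>. So a chain, which is a succession of overlapping words of \<open>M\<close>, is never cut inside a block, and
  in a word whose blocks lie in \<open>L\<close> the subwords from \<open>M\<close> are the subwords from \<open>L1\<close>.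

  The chains of a regular antichain form a regular language (\<open>finite_index_chain_words\<close>): the next
  tail ends where a generator that started inside the previous tail is completed for the first
  time. To detect this, an automaton only has to remember the residuals of the generators begun in the
  previous tail and of those begun in the current one. This automaton cannot distinguish one
  block from another (\<open>block_invariant_chain_words\<close>), since \<open>M\<close> does not.

  So it remains to intersect a regular language \<open>W\<close> that does not distinguish blocks with the words
  whose blocks lie in \<open>L\<close> (\<open>unambiguous_cfl_blocks\<close>). A right-linear grammar for \<open>W\<close> does this if it
  calls the grammar of \<open>L\<close> at each block: a word determines its cut into letters of \<open>X\<close> and blocks,
  hence the derivation outside the blocks, and inside the blocks derivations are unique by assumption.

  Finally \<open>L1\<close> is recovered from its ideal as the minimal basis because it is an antichain
  (\<open>antichain_basis\<close>, \<open>min_basis_monomial_ideal_gen\<close>).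
\<close>

section \<open>Leftmost derivations as lists of productions\<close>

text \<open>A leftmost derivation, as the list of productions it applies. In this form a derivation from a
  concatenation splits into derivations from its two parts (\<open>lparse_append_iff\<close>), which is
  what makes uniqueness of derivations accessible to induction.\<close>

inductive lparse :: "('n \<times> ('n, 't) sym list) set \<Rightarrow> ('n, 't) sym list \<Rightarrow>
    ('n \<times> ('n, 't) sym list) list \<Rightarrow> 't list \<Rightarrow> bool" for P where
  lparse_Nil: "lparse P [] [] []"
| lparse_Tm: "lparse P \<alpha> ps w \<Longrightarrow> lparse P (Tm a # \<alpha>) ps (a # w)"
| lparse_Nt: "(A, \<gamma>) \<in> P \<Longrightarrow> lparse P (\<gamma> @ \<alpha>) ps w \<Longrightarrow> lparse P (Nt A # \<alpha>) ((A, \<gamma>) # ps) w"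

inductive_cases lparse_NilE: "lparse P [] ps w"
inductive_cases lparse_TmE: "lparse P (Tm a # \<alpha>) ps w"
inductive_cases lparse_NtE: "lparse P (Nt A # \<alpha>) ps w"

lemma lparse_Nil_iff [simp]: "lparse P [] ps w \<longleftrightarrow> ps = [] \<and> w = []"
  by (auto elim: lparse_NilE intro: lparse_Nil)

lemma lparse_Tm_iff [simp]: "lparse P (Tm a # \<alpha>) ps w \<longleftrightarrow> (\<exists>w'. w = a # w' \<and> lparse P \<alpha> ps w')"
  by (auto elim: lparse_TmE intro: lparse_Tm)

lemma lparse_Nt_iff:
  "lparse P (Nt A # \<alpha>) ps w \<longleftrightarrow> (\<exists>\<gamma> ps'. ps = (A, \<gamma>) # ps' \<and> (A, \<gamma>) \<in> P \<and> lparse P (\<gamma> @ \<alpha>) ps' w)"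
  by (auto elim: lparse_NtE intro: lparse_Nt)

lemma lparse_terms_iff [simp]:
  "lparse P (map Tm u @ \<alpha>) ps w \<longleftrightarrow> (\<exists>w'. w = u @ w' \<and> lparse P \<alpha> ps w')"
  by (induction u arbitrary: w) auto

lemma lparse_no_prods_iff: "lparse P \<alpha> [] w \<longleftrightarrow> \<alpha> = map Tm w"
proof
  show "\<alpha> = map Tm w" if "lparse P \<alpha> [] w"
  proof -
    have "ps = [] \<Longrightarrow> \<alpha> = map Tm w" if "lparse P \<alpha> ps w" for ps
      using that by (induction rule: lparse.induct) auto
    then show ?thesis using that by blast
  qed
  show "lparse P \<alpha> [] w" if "\<alpha> = map Tm w"
    using lparse_terms_iff[of P w "[]" "[]" w] that by simp
qed

lemma lparse_Cons_iff:
  "lparse P \<alpha> (p # ps) w \<longleftrightarrow>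
    (\<exists>u A v \<gamma>. p = (A, \<gamma>) \<and> (A, \<gamma>) \<in> P \<and> \<alpha> = map Tm u @ Nt A # v \<and>
       lparse P (map Tm u @ \<gamma> @ v) ps w)" (is "?l \<longleftrightarrow> ?r")
proof
  show ?r if ?l
    using that
  proof (induction \<alpha> "p # ps" w)
    case (lparse_Tm \<alpha> w a)
    then obtain u A v \<gamma> where "p = (A, \<gamma>)" "(A, \<gamma>) \<in> P" "\<alpha> = map Tm u @ Nt A # v"
      "lparse P (map Tm u @ \<gamma> @ v) ps w" by blast
    then show ?case by (intro exI[of _ "a # u"] exI[of _ A] exI[of _ v] exI[of _ \<gamma>]) auto
  next
    case (lparse_Nt A \<gamma> \<alpha> w)
    then show ?case by (intro exI[of _ "[]"] exI[of _ A] exI[of _ \<alpha>] exI[of _ \<gamma>]) auto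
  qed
  show ?l if ?r
    using that by (auto simp: lparse_Nt_iff)
qed

lemma lparse_append_iff:
  "lparse P (\<alpha> @ \<beta>) ps w \<longleftrightarrow>
    (\<exists>ps1 ps2 w1 w2. ps = ps1 @ ps2 \<and> w = w1 @ w2 \<and> lparse P \<alpha> ps1 w1 \<and> lparse P \<beta> ps2 w2)"
  (is "?l \<longleftrightarrow> ?r")
proof
  show ?r if ?l
    using that
  proof (induction "\<alpha> @ \<beta>" ps w arbitrary: \<alpha> rule: lparse.induct)
    case lparse_Nil
    then show ?case by auto
  next
    case (lparse_Tm \<delta> ps w a)
    show ?case
    proof (cases \<alpha>)
      case Nil
      then show ?thesis
        using lparse_Tm lparse.lparse_Tm by fastforce
    next
      case (Cons c \<alpha>')
      with lparse_Tm(3) have c: "\<alpha> = Tm a # \<alpha>'" and d: "\<delta> = \<alpha>' @ \<beta>" by auto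
      from lparse_Tm(2)[OF d] show ?thesis unfolding c
        by (metis append_Cons lparse_Tm_iff)
    qed
  next
    case (lparse_Nt A \<gamma> \<delta> ps w)
    show ?case
    proof (cases \<alpha>)
      case Nil
      then have "lparse P \<beta> ((A, \<gamma>) # ps) w"
        using lparse_Nt lparse.lparse_Nt by (metis append_Nil)
      then show ?thesis using Nil by auto
    next
      case (Cons c \<alpha>')
      with lparse_Nt(4) have c: "\<alpha> = Nt A # \<alpha>'" and d: "\<delta> = \<alpha>' @ \<beta>" by auto
      from lparse_Nt(3)[of "\<gamma> @ \<alpha>'"] d obtain ps1 ps2 w1 w2 where
        "ps = ps1 @ ps2" "w = w1 @ w2" "lparse P (\<gamma> @ \<alpha>') ps1 w1" "lparse P \<beta> ps2 w2" by auto
      moreover from this lparse_Nt(1) have "lparse P \<alpha> ((A, \<gamma>) # ps1) w1"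
        unfolding c by (auto simp: lparse_Nt_iff)
      ultimately show ?thesis by (metis append_Cons)
    qed
  qed
  show ?l if ?r
  proof -
    from that obtain ps1 ps2 w1 w2 where e: "ps = ps1 @ ps2" "w = w1 @ w2"
      and p: "lparse P \<alpha> ps1 w1" "lparse P \<beta> ps2 w2" by blast
    from p(1) show ?thesis unfolding e
      by (induction \<alpha> ps1 w1 rule: lparse.induct) (auto simp: p(2) lparse_Nt_iff)
  qed
qed

lemma lparse_derives:
  assumes "lparse (prods G) \<alpha> ps w"
  shows "(derives1 G)\<^sup>*\<^sup>* \<alpha> (map Tm w)"
  using assms
proof (induction ps arbitrary: \<alpha>)
  case Nil
  then show ?case by (simp add: lparse_no_prods_iff)
next
  case (Cons p ps)
  then obtain u A v \<gamma> where "(A, \<gamma>) \<in> prods G" "\<alpha> = map Tm u @ Nt A # v"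
    and *: "lparse (prods G) (map Tm u @ \<gamma> @ v) ps w"
    by (auto simp only: lparse_Cons_iff)
  then have "derives1 G \<alpha> (map Tm u @ \<gamma> @ v)"
    unfolding derives1_def by blast
  with Cons.IH[OF *] show ?case by simp
qed

text \<open>Every derivation can be made leftmost: a production applied somewhere in the middle only
  prolongs the derivation from the piece that it replaces.\<close>

lemma derives_lparse:
  assumes "(derives1 G)\<^sup>*\<^sup>* \<alpha> (map Tm w)"
  shows "\<exists>ps. lparse (prods G) \<alpha> ps w"
  using assms
proof (induction rule: converse_rtranclp_induct)
  case base
  then show ?case using lparse_no_prods_iff by blast
next
  case (step \<alpha> \<beta>)
  then obtain u A v \<gamma> ps where p: "(A, \<gamma>) \<in> prods G" "\<alpha> = u @ Nt A # v" "\<beta> = u @ \<gamma> @ v"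
    "lparse (prods G) \<beta> ps w"
    unfolding derives1_def by blast
  from p(4) obtain ps1 ps2 w1 w2 where w: "w = w1 @ w2" "lparse (prods G) u ps1 w1"
    "lparse (prods G) (\<gamma> @ v) ps2 w2" unfolding p(3) lparse_append_iff[of _ u] by blast
  from w(3) have "lparse (prods G) (Nt A # v) ((A, \<gamma>) # ps2) w2" by (rule lparse_Nt[OF p(1)])
  with w(1,2) have "lparse (prods G) \<alpha> (ps1 @ (A, \<gamma>) # ps2) w"
    unfolding p(2) lparse_append_iff[of _ u] by blast
  then show ?case by blast
qed

lemma cfg_lang_iff_lparse: "w \<in> cfg_lang G \<longleftrightarrow> (\<exists>ps. lparse (prods G) [Nt (start G)] ps w)"
  unfolding cfg_lang_def using lparse_derives derives_lparse by blast

fun expand_leftmost :: "('n, 't) sym list \<Rightarrow> ('n, 't) sym list \<Rightarrow> ('n, 't) sym list" where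
  "expand_leftmost \<gamma> [] = []"
| "expand_leftmost \<gamma> (Tm a # \<alpha>) = Tm a # expand_leftmost \<gamma> \<alpha>"
| "expand_leftmost \<gamma> (Nt A # \<alpha>) = \<gamma> @ \<alpha>"

fun sentential_forms :: "('n, 't) sym list \<Rightarrow> ('n \<times> ('n, 't) sym list) list \<Rightarrow> ('n, 't) sym list list" where
  "sentential_forms \<alpha> [] = [\<alpha>]"
| "sentential_forms \<alpha> ((A, \<gamma>) # ps) = \<alpha> # sentential_forms (expand_leftmost \<gamma> \<alpha>) ps"

lemma expand_leftmost_eq [simp]: "expand_leftmost \<gamma> (map Tm u @ Nt A # v) = map Tm u @ \<gamma> @ v"
  by (induction u) auto

lemma hd_forms [simp]: "sentential_forms \<alpha> ps \<noteq> []" "hd (sentential_forms \<alpha> ps) = \<alpha>"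
  by (cases "(\<alpha>, ps)" rule: sentential_forms.cases; simp)+

lemma leftmost_form_unique:
  "map Tm u @ Nt A # v = map Tm u' @ Nt A' # v' \<Longrightarrow> u = u' \<and> A = A' \<and> v = v'"
proof (induction u arbitrary: u')
  case Nil then show ?case by (cases u') auto
next
  case (Cons a u) then show ?case by (cases u') auto
qed

lemma forms_not_Nil [simp]: "[] \<noteq> sentential_forms \<alpha> ps"
  using hd_forms(1) by metis

lemma forms_inj:
  assumes "lparse P \<alpha> ps w" "lparse P \<alpha> ps' w'" "sentential_forms \<alpha> ps = sentential_forms \<alpha> ps'"
  shows "ps = ps'"
  using assms
proof (induction ps arbitrary: \<alpha> ps')
  case Nil
  then show ?case by (cases ps') auto
next
  case (Cons p ps)
  obtain u A v \<gamma> where p: "p = (A, \<gamma>)" "\<alpha> = map Tm u @ Nt A # v"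
    "lparse P (map Tm u @ \<gamma> @ v) ps w" using Cons.prems(1) by (auto simp only: lparse_Cons_iff)
  obtain p' qs where ps': "ps' = p' # qs" using Cons.prems(3) p by (cases ps') auto
  obtain u' A' v' \<gamma>' where p': "p' = (A', \<gamma>')" "\<alpha> = map Tm u' @ Nt A' # v'"
    "lparse P (map Tm u' @ \<gamma>' @ v') qs w'" using Cons.prems(2) ps' by (auto simp only: lparse_Cons_iff)
  have e: "u' = u" "A' = A" "v' = v" using p(2) p'(2) leftmost_form_unique by metis+
  have f: "sentential_forms (map Tm u @ \<gamma> @ v) ps = sentential_forms (map Tm u @ \<gamma>' @ v) qs"
    using Cons.prems(3) p p' ps' e by simp
  then have "map Tm u @ \<gamma> @ v = map Tm u @ \<gamma>' @ v" using hd_forms(2) by metis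
  then have g: "\<gamma>' = \<gamma>" by simp
  have "ps = qs" using Cons.IH[OF p(3)] p'(3) f e g by auto
  then show ?case using p p' ps' e g by simp
qed

lemma leftmost_steps_iff_forms:
  assumes "d \<noteq> []"
  shows "hd d = \<alpha> \<and> last d = map Tm w \<and> successively (left_derives1 G) d \<longleftrightarrow>
    (\<exists>ps. lparse (prods G) \<alpha> ps w \<and> d = sentential_forms \<alpha> ps)"
proof
  show "\<exists>ps. lparse (prods G) \<alpha> ps w \<and> d = sentential_forms \<alpha> ps"
    if "hd d = \<alpha> \<and> last d = map Tm w \<and> successively (left_derives1 G) d"
    using assms that
  proof (induction d arbitrary: \<alpha> rule: induct_list012)
    case (2 x)
    then show ?case by (intro exI[of _ "[]"]) (auto simp: lparse_no_prods_iff)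
  next
    case (3 x y d)
    have xy: "left_derives1 G x y" using "3.prems" by auto
    obtain ps where ps: "lparse (prods G) y ps w" "y # d = sentential_forms y ps" using "3.IH"(2)[of y] "3.prems" by auto
    obtain u A v \<gamma> where s: "(A, \<gamma>) \<in> prods G" "x = map Tm u @ Nt A # v" "y = map Tm u @ \<gamma> @ v"
      using xy unfolding left_derives1_def by blast
    have "lparse (prods G) x ((A, \<gamma>) # ps) w" using s ps(1) by (auto simp: lparse_Cons_iff)
    moreover have "x # y # d = sentential_forms x ((A, \<gamma>) # ps)" using s ps(2) by simp
    ultimately show ?case using "3.prems" by (metis list.sel(1))
  qed simp
next
  assume "\<exists>ps. lparse (prods G) \<alpha> ps w \<and> d = sentential_forms \<alpha> ps"
  then obtain ps where "lparse (prods G) \<alpha> ps w" and d: "d = sentential_forms \<alpha> ps" by blast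
  then have "last (sentential_forms \<alpha> ps) = map Tm w \<and> successively (left_derives1 G) (sentential_forms \<alpha> ps)"
  proof (induction ps arbitrary: \<alpha> d)
    case Nil
    then show ?case by (simp add: lparse_no_prods_iff)
  next
    case (Cons p ps)
    then obtain u A v \<gamma> where s: "p = (A, \<gamma>)" "(A, \<gamma>) \<in> prods G" "\<alpha> = map Tm u @ Nt A # v"
      and *: "lparse (prods G) (map Tm u @ \<gamma> @ v) ps w"
      by (auto simp only: lparse_Cons_iff)
    then have "left_derives1 G \<alpha> (map Tm u @ \<gamma> @ v)" unfolding left_derives1_def by blast
    with Cons.IH[OF * refl] show ?case
      by (simp add: s(1,3) successively_Cons)
  qed
  then show "hd d = \<alpha> \<and> last d = map Tm w \<and> successively (left_derives1 G) d" using d by simp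
qed

lemma leftmost_derivation_iff_forms:
  "leftmost_derivation G w d \<longleftrightarrow>
    (\<exists>ps. lparse (prods G) [Nt (start G)] ps w \<and> d = sentential_forms [Nt (start G)] ps)"
proof (cases "d = []")
  case False
  then show ?thesis
    using leftmost_steps_iff_forms[of d "[Nt (start G)]" w G]
    by (simp add: leftmost_derivation_def successively_conv_nth)
qed (simp add: leftmost_derivation_def)

text \<open>Lists of sentential forms and lists of productions determine each other (\<open>forms_inj\<close>), so
  unambiguity can be tested on the latter.\<close>

lemma unambiguous_cfl_iff_lparse:
  "unambiguous_cfl M \<longleftrightarrow>
    (\<exists>(P :: (nat \<times> (nat, 't) sym list) set) S. finite P \<and>
       (\<forall>w. w \<in> M \<longleftrightarrow> (\<exists>ps. lparse P [Nt S] ps w)) \<and>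
       (\<forall>w ps ps'. lparse P [Nt S] ps w \<longrightarrow> lparse P [Nt S] ps' w \<longrightarrow> ps = ps'))"
proof -
  have u: "unambiguous_cfg G \<longleftrightarrow> (\<forall>w ps ps'. lparse (prods G) [Nt (start G)] ps w \<longrightarrow>
      lparse (prods G) [Nt (start G)] ps' w \<longrightarrow> ps = ps')" for G :: "(nat, 't) cfg"
  proof
    show "\<forall>w ps ps'. lparse (prods G) [Nt (start G)] ps w \<longrightarrow>
      lparse (prods G) [Nt (start G)] ps' w \<longrightarrow> ps = ps'" if "unambiguous_cfg G"
    proof (intro allI impI)
      fix w ps ps'
      assume p: "lparse (prods G) [Nt (start G)] ps w" "lparse (prods G) [Nt (start G)] ps' w"
      then have "\<exists>!d. leftmost_derivation G w d"
        using that cfg_lang_iff_lparse unfolding unambiguous_cfg_def by blast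
      then have "sentential_forms [Nt (start G)] ps = sentential_forms [Nt (start G)] ps'"
        using p leftmost_derivation_iff_forms by blast
      then show "ps = ps'" using forms_inj p by blast
    qed
    show "unambiguous_cfg G" if "\<forall>w ps ps'. lparse (prods G) [Nt (start G)] ps w \<longrightarrow>
      lparse (prods G) [Nt (start G)] ps' w \<longrightarrow> ps = ps'"
      unfolding unambiguous_cfg_def leftmost_derivation_iff_forms
    proof
      fix w
      assume "w \<in> cfg_lang G"
      then obtain ps where "lparse (prods G) [Nt (start G)] ps w"
        using cfg_lang_iff_lparse by blast
      with that show "\<exists>!d. \<exists>ps. lparse (prods G) [Nt (start G)] ps w \<and> d = sentential_forms [Nt (start G)] ps"
        by (intro ex1I[of _ "sentential_forms [Nt (start G)] ps"]) auto
    qed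
  qed
  show ?thesis
  proof
    assume "unambiguous_cfl M"
    then obtain G :: "(nat, 't) cfg" where "finite (prods G)" "unambiguous_cfg G" "cfg_lang G = M"
      unfolding unambiguous_cfl_def by blast
    then show "\<exists>(P :: (nat \<times> (nat, 't) sym list) set) S. finite P \<and>
       (\<forall>w. w \<in> M \<longleftrightarrow> (\<exists>ps. lparse P [Nt S] ps w)) \<and>
       (\<forall>w ps ps'. lparse P [Nt S] ps w \<longrightarrow> lparse P [Nt S] ps' w \<longrightarrow> ps = ps')"
      using u[of G] cfg_lang_iff_lparse[of _ G]
      by (intro exI[of _ "prods G"] exI[of _ "start G"]) simp
  next
    assume "\<exists>(P :: (nat \<times> (nat, 't) sym list) set) S. finite P \<and>
       (\<forall>w. w \<in> M \<longleftrightarrow> (\<exists>ps. lparse P [Nt S] ps w)) \<and>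
       (\<forall>w ps ps'. lparse P [Nt S] ps w \<longrightarrow> lparse P [Nt S] ps' w \<longrightarrow> ps = ps')"
    then obtain P :: "(nat \<times> (nat, 't) sym list) set" and S where "finite P"
       "\<forall>w. w \<in> M \<longleftrightarrow> (\<exists>ps. lparse P [Nt S] ps w)"
       "\<forall>w ps ps'. lparse P [Nt S] ps w \<longrightarrow> lparse P [Nt S] ps' w \<longrightarrow> ps = ps'" by blast
    then show "unambiguous_cfl M"
      unfolding unambiguous_cfl_def u
      by (intro exI[of _ "\<lparr>prods = P, start = S\<rparr>"]) (auto simp: cfg_lang_iff_lparse)
  qed
qed

section \<open>Regularity by left quotients\<close>

definition lquot :: "'a list \<Rightarrow> 'a list set \<Rightarrow> 'a list set" where
  "lquot u M = {w. u @ w \<in> M}"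

lemma in_lquot [simp]: "w \<in> lquot u M \<longleftrightarrow> u @ w \<in> M"
  by (simp add: lquot_def)

lemma lquot_lquot [simp]: "lquot u (lquot v M) = lquot (v @ u) M"
  by auto

lemma lquot_Nil [simp]: "lquot [] M = M"
  by auto

text \<open>Over a finite alphabet this is regularity, by the Myhill--Nerode theorem. The quotients
  themselves serve as the states of an automaton, so that none has to be chosen.\<close>

definition finite_index :: "'a list set \<Rightarrow> bool" where
  "finite_index M \<longleftrightarrow> finite (range (\<lambda>u. lquot u M))"

lemma finite_index_Un: "finite_index A \<Longrightarrow> finite_index B \<Longrightarrow> finite_index (A \<union> B)"
proof -
  assume fin: "finite_index A" "finite_index B"
  have "range (\<lambda>u. lquot u (A \<union> B)) \<subseteq>
      (\<lambda>(K, K'). K \<union> K') ` (range (\<lambda>u. lquot u A) \<times> range (\<lambda>u. lquot u B))"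
  proof
    fix K assume "K \<in> range (\<lambda>u. lquot u (A \<union> B))"
    then obtain u where "K = lquot u A \<union> lquot u B" by (auto simp: lquot_def)
    then show "K \<in> (\<lambda>(K, K'). K \<union> K') ` (range (\<lambda>u. lquot u A) \<times> range (\<lambda>u. lquot u B))" by blast
  qed
  then show ?thesis using fin unfolding finite_index_def by (rule finite_subset[OF _ finite_imageI[OF finite_cartesian_product]])
qed

lemma finite_index_empty: "finite_index {}"
  by (simp add: finite_index_def lquot_def)

lemma finite_index_UN:
  "finite J \<Longrightarrow> (\<And>i. i \<in> J \<Longrightarrow> finite_index (A i)) \<Longrightarrow> finite_index (\<Union>i\<in>J. A i)"
  by (induction rule: finite_induct) (auto simp: finite_index_Un finite_index_empty)

text \<open>A word of the product that begins with \<open>u\<close> is cut either after \<open>u\<close>, or inside \<open>u\<close> and then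
  leaves a suffix of \<open>u\<close> to the second factor.\<close>

lemma lquot_lang_prod:
  "lquot u (A \<cdot>\<cdot> B) = lquot u A \<cdot>\<cdot> B \<union> (\<Union>v\<in>{v. \<exists>a. u = a @ v \<and> a \<in> A}. lquot v B)"
proof (intro equalityI subsetI)
  fix w assume "w \<in> lquot u (A \<cdot>\<cdot> B)"
  then obtain a b where "u @ w = a @ b" "a \<in> A" "b \<in> B" by (auto simp: lang_prod_def)
  then show "w \<in> lquot u A \<cdot>\<cdot> B \<union> (\<Union>v\<in>{v. \<exists>a. u = a @ v \<and> a \<in> A}. lquot v B)"
    by (auto simp: append_eq_append_conv2 lang_prod_def)
next
  fix w assume "w \<in> lquot u A \<cdot>\<cdot> B \<union> (\<Union>v\<in>{v. \<exists>a. u = a @ v \<and> a \<in> A}. lquot v B)"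
  then consider a b where "w = a @ b" "u @ a \<in> A" "b \<in> B" | a v where "u = a @ v" "a \<in> A" "v @ w \<in> B"
    by (auto simp: lang_prod_def)
  then have "\<exists>a b. u @ w = a @ b \<and> a \<in> A \<and> b \<in> B"
    by cases (metis append.assoc)+
  then show "w \<in> lquot u (A \<cdot>\<cdot> B)" by (simp add: lang_prod_def)
qed

lemma finite_index_lang_prod:
  assumes "finite_index A" "finite_index B"
  shows "finite_index (A \<cdot>\<cdot> B)"
proof -
  have "range (\<lambda>u. lquot u (A \<cdot>\<cdot> B)) \<subseteq>
      (\<lambda>(K, U). K \<cdot>\<cdot> B \<union> \<Union>U) ` (range (\<lambda>u. lquot u A) \<times> Pow (range (\<lambda>u. lquot u B)))"
    unfolding lquot_lang_prod by (auto simp: image_iff)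
  moreover have "finite (range (\<lambda>u. lquot u A) \<times> Pow (range (\<lambda>u. lquot u B)))"
    using assms unfolding finite_index_def by simp
  ultimately show ?thesis unfolding finite_index_def using finite_subset finite_imageI by metis
qed

lemma finite_index_lists: "finite_index (lists Y - {[]})"
proof -
  have "lquot u (lists Y - {[]}) \<in> {lists Y - {[]}, lists Y, {}}" for u
    by (cases "u \<in> lists Y"; cases "u = []") (auto simp: lquot_def)
  then have "range (\<lambda>u. lquot u (lists Y - {[]})) \<subseteq> {lists Y - {[]}, lists Y, {}}" by blast
  then show ?thesis unfolding finite_index_def by (rule finite_subset) simp
qed

lemma finite_index_regular_lang:
  assumes "regular_lang X M"
  shows "finite_index M"
proof -
  obtain Q :: "nat set" and q0 \<delta> Acc where Q: "finite Q" "q0 \<in> Q" "\<And>q a. q \<in> Q \<Longrightarrow> a \<in> X \<Longrightarrow> \<delta> q a \<in> Q"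
    and M: "M = {w \<in> lists X. foldl \<delta> q0 w \<in> Acc}"
    using assms unfolding regular_lang_def by blast
  have closed: "foldl \<delta> q u \<in> Q" if "q \<in> Q" "u \<in> lists X" for q u
    using that(2,1) by (induction u arbitrary: q) (auto simp: Q(3))
  have "lquot u M \<in> insert {} ((\<lambda>q. {w \<in> lists X. foldl \<delta> q w \<in> Acc}) ` Q)" for u
  proof (cases "u \<in> lists X")
    case True
    then have "lquot u M = {w \<in> lists X. foldl \<delta> (foldl \<delta> q0 u) w \<in> Acc}" unfolding M by auto
    then show ?thesis using closed[OF Q(2) True] by blast
  next
    case False
    then have "lquot u M = {}" unfolding M by auto
    then show ?thesis by blast
  qed
  then have "range (\<lambda>u. lquot u M) \<subseteq> insert {} ((\<lambda>q. {w \<in> lists X. foldl \<delta> q w \<in> Acc}) ` Q)" by blast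
  then show ?thesis unfolding finite_index_def by (rule finite_subset) (simp add: Q(1))
qed

section \<open>Words composed of letters and blocks\<close>

definition block_invariant :: "'a set \<Rightarrow> 'a list set \<Rightarrow> bool" where
  "block_invariant Y M \<longleftrightarrow>
    (\<forall>l\<in>lists Y - {[]}. \<forall>l'\<in>lists Y - {[]}. \<forall>u w. u @ l @ w \<in> M \<longrightarrow> u @ l' @ w \<in> M)"

text \<open>For \<open>L\<close> a language of nonempty words over an alphabet disjoint from \<open>X\<close>: the words all of whose
  blocks are in \<open>L\<close> and which do not end in a block. Each block is taken together with the letter
  of \<open>X\<close> after it; this keeps two blocks from standing side by side, where their border would be
  invisible.\<close>

inductive_set blocks :: "'a set \<Rightarrow> 'a list set \<Rightarrow> 'a list set" for X L where
  blocks_Nil: "[] \<in> blocks X L"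
| blocks_letter: "x \<in> X \<Longrightarrow> w \<in> blocks X L \<Longrightarrow> x # w \<in> blocks X L"
| blocks_block: "l \<in> L \<Longrightarrow> x \<in> X \<Longrightarrow> w \<in> blocks X L \<Longrightarrow> l @ x # w \<in> blocks X L"

lemma block_append_eq:
  assumes "X \<inter> Y = {}" "l \<in> lists Y" "l' \<in> lists Y" "x \<in> X" "x' \<in> X" "l @ x # w = l' @ x' # w'"
  shows "l = l' \<and> x = x' \<and> w = w'"
  using assms(2,3,6)
proof (induction l arbitrary: l')
  case Nil
  then show ?case using assms(1,4) by (cases l') auto
next
  case (Cons a l)
  then show ?case using assms(1,5) by (cases l') auto
qed

lemma blocks_append: "u \<in> blocks X L \<Longrightarrow> v \<in> blocks X L \<Longrightarrow> u @ v \<in> blocks X L"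
  by (induction rule: blocks.induct) (auto intro: blocks.intros)

lemma blocks_letter_iff:
  assumes XY: "X \<inter> Y = {}" and LY: "L \<subseteq> lists Y - {[]}" and "x \<in> X"
  shows "x # w \<in> blocks X L \<longleftrightarrow> w \<in> blocks X L"
proof
  assume "x # w \<in> blocks X L"
  then show "w \<in> blocks X L"
  proof cases
    case (blocks_block l x' w')
    then obtain y l' where "l = y # l'" "y \<in> Y" using LY by (cases l) auto
    then show ?thesis using blocks_block(1) \<open>x \<in> X\<close> XY by auto
  qed
qed (rule blocks_letter[OF \<open>x \<in> X\<close>])

lemma blocks_block_iff:
  assumes XY: "X \<inter> Y = {}" and LY: "L \<subseteq> lists Y - {[]}" and "l \<in> lists Y - {[]}" "x \<in> X"
  shows "l @ x # w \<in> blocks X L \<longleftrightarrow> l \<in> L \<and> w \<in> blocks X L"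
proof
  assume "l @ x # w \<in> blocks X L"
  then show "l \<in> L \<and> w \<in> blocks X L"
  proof cases
    case (blocks_letter x' w')
    then show ?thesis using assms(1,3) by (cases l) auto
  next
    case (blocks_block l' x' w')
    then show ?thesis using block_append_eq[OF XY, of l l' x x' w w'] assms(3,4) LY by auto
  qed simp
qed (use assms in \<open>auto intro: blocks_block\<close>)

text \<open>The pieces \<open>x\<close> and \<open>l x\<close> out of which these words are built form a prefix code, so
  cancellation on the left is possible.\<close>

lemma blocks_cancel:
  assumes "X \<inter> Y = {}" "L \<subseteq> lists Y - {[]}" "u \<in> blocks X L" "u @ v \<in> blocks X L"
  shows "v \<in> blocks X L"
  using assms(3,4)
proof (induction rule: blocks.induct)
  case (blocks_letter x w)
  then show ?case using blocks_letter_iff[OF assms(1,2)] by auto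
next
  case (blocks_block l x w)
  then show ?case using blocks_block_iff[OF assms(1,2), of l x "w @ v"] assms(2) by auto
qed simp

text \<open>A cut after a letter of \<open>X\<close> does not fall into a block.\<close>

lemma blocks_prefix:
  assumes XY: "X \<inter> Y = {}" and LY: "L \<subseteq> lists Y - {[]}"
  shows "u @ v \<in> blocks X L \<Longrightarrow> u = [] \<or> last u \<in> X \<Longrightarrow> u \<in> blocks X L"
proof (induction "u @ v" arbitrary: u rule: blocks.induct)
  case blocks_Nil
  then show ?case by (auto intro: blocks.intros)
next
  case (blocks_letter x w)
  show ?case
  proof (cases u)
    case Nil
    then show ?thesis by (simp add: blocks.blocks_Nil)
  next
    case (Cons a u')
    with blocks_letter(4) have "a = x" "w = u' @ v" by auto
    moreover have "u' = [] \<or> last u' \<in> X" using blocks_letter(5) Cons by (cases "u' = []") auto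
    ultimately show ?thesis using blocks_letter(1,3) Cons by (auto intro: blocks.blocks_letter)
  qed
next
  case (blocks_block l x w)
  from blocks_block(5) consider u' where "l = u @ u'" | u' where "u = l @ x # u'" "w = u' @ v"
    by (auto simp: append_eq_append_conv2 Cons_eq_append_conv)
  then show ?case
  proof cases
    case 1
    have "u = []"
    proof (rule ccontr)
      assume "u \<noteq> []"
      moreover from this have "last u \<in> set l" using 1 by auto
      ultimately show False using blocks_block(1,6) LY XY by auto
    qed
    then show ?thesis by (simp add: blocks.blocks_Nil)
  next
    case 2
    then have "u' = [] \<or> last u' \<in> X" using blocks_block(6) by (cases "u' = []") auto
    then show ?thesis using 2 blocks_block by (auto intro: blocks.blocks_block)
  qed
qed

text \<open>A cut before a letter of \<open>X\<close> may separate a block from the letter closing it, which leaves the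
  second part intact.\<close>

lemma blocks_suffix:
  assumes XY: "X \<inter> Y = {}" and LY: "L \<subseteq> lists Y - {[]}"
  shows "u @ v \<in> blocks X L \<Longrightarrow> v \<noteq> [] \<Longrightarrow> hd v \<in> X \<Longrightarrow> v \<in> blocks X L"
proof (induction "u @ v" arbitrary: u rule: blocks.induct)
  case (blocks_letter x w)
  then show ?case by (cases u) (auto intro: blocks.blocks_letter)
next
  case (blocks_block l x w)
  from blocks_block(5) consider u' where "l = u @ u'" "v = u' @ x # w" | u' where "u = l @ x # u'" "w = u' @ v"
    by (auto simp: append_eq_append_conv2 Cons_eq_append_conv)
  then show ?case
  proof cases
    case 1
    have "u' = []"
    proof (rule ccontr)
      assume "u' \<noteq> []"
      moreover from this have "hd v \<in> set l" using 1 by auto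
      ultimately show False using blocks_block(1,7) LY XY by auto
    qed
    then show ?thesis using 1 blocks_block(2,3) by (auto intro: blocks.blocks_letter)
  next
    case 2
    then show ?thesis using blocks_block by blast
  qed
qed simp

section \<open>Filling the blocks of a regular language\<close>

text \<open>The variables of the grammar of \<open>L\<close> are renamed to odd numbers, to keep the even ones for
  the left quotients of the regular language.\<close>

primrec odd_sym :: "(nat, 't) sym \<Rightarrow> (nat, 't) sym" where
  "odd_sym (Nt A) = Nt (2 * A + 1)"
| "odd_sym (Tm a) = Tm a"

definition odd_prod :: "nat \<times> (nat, 't) sym list \<Rightarrow> nat \<times> (nat, 't) sym list" where
  "odd_prod p = (2 * fst p + 1, map odd_sym (snd p))"

lemma odd_sym_eq_iff [simp]:
  "odd_sym c = Tm a \<longleftrightarrow> c = Tm a" "odd_sym c = Nt A \<longleftrightarrow> (\<exists>B. c = Nt B \<and> A = 2 * B + 1)"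
  "Tm a = odd_sym c \<longleftrightarrow> c = Tm a" "Nt A = odd_sym c \<longleftrightarrow> (\<exists>B. c = Nt B \<and> A = 2 * B + 1)"
  by (cases c; auto)+

lemma lparse_odd_prod_iff:
  assumes "\<And>A \<gamma>. (A, \<gamma>) \<in> P' \<Longrightarrow> even A"
  shows "lparse (odd_prod ` P \<union> P') (map odd_sym \<alpha>) ps w \<longleftrightarrow>
    (\<exists>qs. ps = map odd_prod qs \<and> lparse P \<alpha> qs w)" (is "?l \<longleftrightarrow> ?r")
proof
  show ?r if ?l
    using that
  proof (induction "map odd_sym \<alpha>" ps w arbitrary: \<alpha> rule: lparse.induct)
    case lparse_Nil
    then show ?case by auto
  next
    case (lparse_Tm \<beta> ps w a)
    then obtain \<alpha>' where a: "\<alpha> = Tm a # \<alpha>'" "\<beta> = map odd_sym \<alpha>'"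
      by (auto simp: Cons_eq_map_conv)
    then show ?case using lparse_Tm(2)[of \<alpha>'] by auto
  next
    case (lparse_Nt A \<gamma> \<beta> ps w)
    then obtain B \<alpha>' where a: "\<alpha> = Nt B # \<alpha>'" "\<beta> = map odd_sym \<alpha>'" "A = 2 * B + 1"
      by (auto simp: Cons_eq_map_conv)
    then have "(A, \<gamma>) \<in> odd_prod ` P" using lparse_Nt(1) assms[of A \<gamma>] a(3) by auto
    then obtain \<delta> where d: "(B, \<delta>) \<in> P" "\<gamma> = map odd_sym \<delta>" using a(3) unfolding odd_prod_def by auto
    obtain qs where "ps = map odd_prod qs" "lparse P (\<delta> @ \<alpha>') qs w"
      using lparse_Nt(3)[of "\<delta> @ \<alpha>'"] a d by auto
    then show ?case using a d
      by (intro exI[of _ "(B, \<delta>) # qs"]) (auto simp: odd_prod_def lparse_Nt_iff)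
  qed
  show ?l if ?r
  proof -
    from that obtain qs where ps: "ps = map odd_prod qs" and "lparse P \<alpha> qs w" by blast
    from this(2) show ?l unfolding ps
    proof (induction \<alpha> qs w rule: lparse.induct)
      case (lparse_Nt A \<gamma> \<alpha> ps w)
      then have "odd_prod (A, \<gamma>) \<in> odd_prod ` P" by blast
      then show ?case using lparse_Nt by (auto simp: odd_prod_def lparse_Nt_iff)
    qed auto
  qed
qed

text \<open>A quotient \<open>K\<close> has the productions \<open>K \<rightarrow> x K'\<close> with \<open>K'\<close> the quotient of \<open>K\<close> by the letter \<open>x\<close>, then
  \<open>K \<rightarrow> S x K'\<close> with \<open>S\<close> the start variable for \<open>L\<close> and \<open>K'\<close> the quotient of \<open>K\<close> by a block followed
  by \<open>x\<close>, and \<open>K \<rightarrow> \<epsilon>\<close> if \<open>K\<close> contains the empty word. In the second kind \<open>K'\<close> is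
  independent of the block because \<open>W\<close> is block invariant. The first letter of a word tells
  which kind of production is used first, and the first letter of \<open>X\<close> in it where the block ends.\<close>

lemma unambiguous_cfl_blocks:
  fixes W L :: "'a list set"
  assumes "finite X" and XY: "X \<inter> Y = {}" and LY: "L \<subseteq> lists Y - {[]}" and "unambiguous_cfl L"
    and "finite_index W" and inv: "block_invariant Y W"
  shows "unambiguous_cfl (W \<inter> blocks X L)"
proof -
  obtain P :: "(nat \<times> (nat, 'a) sym list) set" and S where "finite P"
    and L_iff: "\<And>w. w \<in> L \<longleftrightarrow> (\<exists>ps. lparse P [Nt S] ps w)"
    and L_unique: "\<And>w ps ps'. lparse P [Nt S] ps w \<Longrightarrow> lparse P [Nt S] ps' w \<Longrightarrow> ps = ps'"
    using \<open>unambiguous_cfl L\<close> unfolding unambiguous_cfl_iff_lparse by metis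
  define Q where "Q = range (\<lambda>u. lquot u W)"
  have finQ: "finite Q" using \<open>finite_index W\<close> unfolding Q_def finite_index_def .
  have Q_lquot: "lquot u K \<in> Q" if "K \<in> Q" for u K using that unfolding Q_def by auto
  have WQ: "W \<in> Q" unfolding Q_def by (rule range_eqI[of _ _ "[]"]) simp
  obtain h :: "'a list set \<Rightarrow> nat" where h: "inj_on h Q"
    using finite_imp_inj_to_nat_seg[OF finQ] by blast
  define E where "E K = 2 * h K" for K
  have E_inj: "E K = E K' \<longleftrightarrow> K = K'" if "K \<in> Q" "K' \<in> Q" for K K'
    using that h unfolding E_def inj_on_def by auto
  have E_even: "even (E K)" "E K \<noteq> Suc (2 * A)" for K A unfolding E_def by auto presburger
  \<comment> \<open>Any block stands for all of them; if \<open>L\<close> is empty, the value is never used in a derivation.\<close>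
  define l0 where "l0 = (SOME l. l \<in> L)"
  have l0: "lquot (l @ [x]) K = lquot (l0 @ [x]) K" if "l \<in> L" "K \<in> Q" for l x K
  proof -
    have "l0 \<in> L" unfolding l0_def using that(1) by (rule someI)
    then have "l \<in> lists Y - {[]}" "l0 \<in> lists Y - {[]}" using that LY by auto
    with inv have "u @ l @ v \<in> W \<longleftrightarrow> u @ l0 @ v \<in> W" for u v
      unfolding block_invariant_def by blast
    moreover from that obtain u where "K = lquot u W" unfolding Q_def by blast
    ultimately show ?thesis by (simp add: set_eq_iff)
  qed
  define P1 where "P1 = (\<lambda>(K, x). (E K, [Tm x, Nt (E (lquot [x] K))])) ` (Q \<times> X)"
  define P2 where
    "P2 = (\<lambda>(K, x). (E K, [Nt (2 * S + 1), Tm x, Nt (E (lquot (l0 @ [x]) K))])) ` (Q \<times> X)"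
  define P3 where "P3 = (\<lambda>K. (E K, [] :: (nat, 'a) sym list)) ` {K \<in> Q. [] \<in> K}"
  define P' where "P' = odd_prod ` P \<union> (P1 \<union> P2 \<union> P3)"
  have "finite P'"
    unfolding P'_def P1_def P2_def P3_def using finQ \<open>finite X\<close> \<open>finite P\<close> by simp
  have L_parse: "lparse P' (Nt (2 * S + 1) # \<alpha>) ps w \<longleftrightarrow>
      (\<exists>qs ps' l w'. ps = map odd_prod qs @ ps' \<and> w = l @ w' \<and> lparse P [Nt S] qs l \<and> lparse P' \<alpha> ps' w')"
    for \<alpha> ps w
  proof -
    have *: "lparse P' [Nt (2 * S + 1)] ps w \<longleftrightarrow> (\<exists>qs. ps = map odd_prod qs \<and> lparse P [Nt S] qs w)"
      for ps w
    proof -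
      have "lparse P' (map odd_sym [Nt S]) ps w \<longleftrightarrow> (\<exists>qs. ps = map odd_prod qs \<and> lparse P [Nt S] qs w)"
        unfolding P'_def by (rule lparse_odd_prod_iff) (auto simp: P1_def P2_def P3_def E_even)
      then show ?thesis by simp
    qed
    have "lparse P' ([Nt (2 * S + 1)] @ \<alpha>) ps w \<longleftrightarrow>
      (\<exists>qs ps' l w'. ps = map odd_prod qs @ ps' \<and> w = l @ w' \<and> lparse P [Nt S] qs l \<and> lparse P' \<alpha> ps' w')"
      unfolding lparse_append_iff[of P' "[Nt (2 * S + 1)]"] * by blast
    then show ?thesis by simp
  qed
  have P1_iff: "(E K, \<gamma>) \<in> P1 \<longleftrightarrow> (\<exists>x\<in>X. \<gamma> = [Tm x, Nt (E (lquot [x] K))])" if "K \<in> Q" for K \<gamma>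
    unfolding P1_def using that E_inj by (auto simp: image_iff)
  have P2_iff: "(E K, \<gamma>) \<in> P2 \<longleftrightarrow>
      (\<exists>x\<in>X. \<gamma> = [Nt (2 * S + 1), Tm x, Nt (E (lquot (l0 @ [x]) K))])" if "K \<in> Q" for K \<gamma>
    unfolding P2_def using that E_inj by (auto simp: image_iff)
  have P3_iff: "(E K, \<gamma>) \<in> P3 \<longleftrightarrow> \<gamma> = [] \<and> [] \<in> K" if "K \<in> Q" for K \<gamma>
    unfolding P3_def using that E_inj by (auto simp: image_iff)
  have "(E K, \<gamma>) \<notin> odd_prod ` P" for K \<gamma>
    unfolding odd_prod_def by (auto simp: E_even(2))
  then have prods: "(E K, \<gamma>) \<in> P' \<longleftrightarrow> (\<exists>x\<in>X. \<gamma> = [Tm x, Nt (E (lquot [x] K))]) \<or>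
      (\<exists>x\<in>X. \<gamma> = [Nt (2 * S + 1), Tm x, Nt (E (lquot (l0 @ [x]) K))]) \<or> (\<gamma> = [] \<and> [] \<in> K)"
    if "K \<in> Q" for K \<gamma>
    unfolding P'_def Un_iff P1_iff[OF that] P2_iff[OF that] P3_iff[OF that] by blast
  have L_parse': "lparse P' [Nt (2 * S + 1), Tm x, Nt A] ps w \<longleftrightarrow>
      (\<exists>l\<in>L. \<exists>w' qs ps'. w = l @ x # w' \<and> ps = map odd_prod qs @ ps' \<and>
         lparse P [Nt S] qs l \<and> lparse P' [Nt A] ps' w')" for x A ps w
    unfolding L_parse lparse_Tm_iff using L_iff by blast
  \<comment> \<open>Derivations from \<open>K\<close> by their first production; the rest is induction over the word.\<close>
  have parse: "lparse P' [Nt (E K)] ps w \<longleftrightarrow>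
      (\<exists>x\<in>X. \<exists>w' ps'. w = x # w' \<and> ps = (E K, [Tm x, Nt (E (lquot [x] K))]) # ps' \<and>
         lparse P' [Nt (E (lquot [x] K))] ps' w') \<or>
      (\<exists>l\<in>L. \<exists>x\<in>X. \<exists>w' qs ps'. w = l @ x # w' \<and>
         ps = (E K, [Nt (2 * S + 1), Tm x, Nt (E (lquot (l0 @ [x]) K))]) # map odd_prod qs @ ps' \<and>
         lparse P [Nt S] qs l \<and> lparse P' [Nt (E (lquot (l0 @ [x]) K))] ps' w') \<or>
      (w = [] \<and> ps = [(E K, [])] \<and> [] \<in> K)" (is "_ \<longleftrightarrow> ?letter \<or> ?block \<or> ?stop")
    if "K \<in> Q" for K ps w
  proof
    assume "lparse P' [Nt (E K)] ps w"
    then obtain \<gamma> ps' where ps: "ps = (E K, \<gamma>) # ps'" and \<gamma>: "(E K, \<gamma>) \<in> P'"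
      and "lparse P' \<gamma> ps' w" by (auto simp: lparse_Nt_iff)
    from \<gamma>[unfolded prods[OF that]] this(3) show "?letter \<or> ?block \<or> ?stop"
    proof (elim disjE bexE)
      fix x assume "x \<in> X" "lparse P' \<gamma> ps' w" "\<gamma> = [Tm x, Nt (E (lquot [x] K))]"
      then have ?letter unfolding ps by (auto intro!: bexI[of _ x])
      then show ?thesis ..
    next
      fix x assume x: "x \<in> X" and "lparse P' \<gamma> ps' w"
        and \<gamma>: "\<gamma> = [Nt (2 * S + 1), Tm x, Nt (E (lquot (l0 @ [x]) K))]"
      then have ?block unfolding ps \<gamma> L_parse' using x by blast
      then show ?thesis by blast
    qed (simp add: ps)
  next
    assume "?letter \<or> ?block \<or> ?stop"
    then show "lparse P' [Nt (E K)] ps w"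
    proof (elim disjE)
      assume ?letter
      then obtain x w' ps' where *: "x \<in> X" "w = x # w'"
        "ps = (E K, [Tm x, Nt (E (lquot [x] K))]) # ps'" "lparse P' [Nt (E (lquot [x] K))] ps' w'" by blast
      then have "lparse P' [Tm x, Nt (E (lquot [x] K))] ps' w" by simp
      then show ?thesis unfolding *(3) using lparse_Nt[of "E K" _ P' "[]"] prods[OF that] \<open>x \<in> X\<close>
        by (metis append_Nil2)
    next
      assume ?block
      then obtain l x w' qs ps' where *: "l \<in> L" "x \<in> X" "w = l @ x # w'"
        "ps = (E K, [Nt (2 * S + 1), Tm x, Nt (E (lquot (l0 @ [x]) K))]) # map odd_prod qs @ ps'"
        "lparse P [Nt S] qs l" "lparse P' [Nt (E (lquot (l0 @ [x]) K))] ps' w'" by blast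
      then have "lparse P' [Nt (2 * S + 1), Tm x, Nt (E (lquot (l0 @ [x]) K))] (map odd_prod qs @ ps') w"
        unfolding L_parse' by blast
      then show ?thesis unfolding *(4) using lparse_Nt[of "E K" _ P' "[]"] prods[OF that] \<open>x \<in> X\<close>
        by (metis append_Nil2)
    next
      assume ?stop
      then show ?thesis using prods[OF that, of "[]"] by (simp add: lparse_Nt_iff)
    qed
  qed
  have complete: "\<exists>ps. lparse P' [Nt (E K)] ps w" if "w \<in> blocks X L" "w \<in> K" "K \<in> Q" for w K
    using that
  proof (induction arbitrary: K rule: blocks.induct)
    case blocks_Nil
    then show ?case by (auto simp: parse)
  next
    case (blocks_letter x w)
    then have "\<exists>ps. lparse P' [Nt (E (lquot [x] K))] ps w" using Q_lquot by simp
    then show ?case unfolding parse[OF blocks_letter.prems(2)] using blocks_letter(1) by blast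
  next
    case (blocks_block l x w)
    then have "w \<in> lquot (l0 @ [x]) K" using l0[of l K x] by (metis append.assoc append_Cons append_Nil in_lquot)
    then have "\<exists>ps. lparse P' [Nt (E (lquot (l0 @ [x]) K))] ps w"
      using blocks_block.IH blocks_block.prems(2) Q_lquot by blast
    moreover have "\<exists>qs. lparse P [Nt S] qs l" using blocks_block(1) L_iff by blast
    ultimately show ?case unfolding parse[OF blocks_block.prems(2)] using blocks_block(1,2) by blast
  qed
  have sound: "w \<in> blocks X L \<and> w \<in> K" if "lparse P' [Nt (E K)] ps w" "K \<in> Q" for w K ps
    using that
  proof (induction w arbitrary: K ps rule: length_induct)
    case (1 w)
    have IH: "w' \<in> blocks X L \<and> w' \<in> K'" if "length w' < length w" "lparse P' [Nt (E K')] ps' w'" "K' \<in> Q"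
      for w' K' ps' using 1(1) that by blast
    from 1(2)[unfolded parse[OF 1(3)]] show ?case
    proof (elim disjE bexE exE conjE)
      fix x w' ps' assume "x \<in> X" "w = x # w'" "lparse P' [Nt (E (lquot [x] K))] ps' w'"
      then show ?thesis using IH[of w' "lquot [x] K" ps'] Q_lquot[OF 1(3)] by (auto intro: blocks_letter)
    next
      fix l x w' qs ps'
      assume *: "l \<in> L" "x \<in> X" "w = l @ x # w'" "lparse P' [Nt (E (lquot (l0 @ [x]) K))] ps' w'"
      then have "w' \<in> blocks X L \<and> w' \<in> lquot (l0 @ [x]) K"
        using IH[of w' "lquot (l0 @ [x]) K" ps'] Q_lquot[OF 1(3)] by auto
      then show ?thesis using * l0[OF *(1) 1(3), of x, symmetric] by (auto intro: blocks_block)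
    qed (auto intro: blocks_Nil)
  qed
  have unique: "ps = ps'" if "lparse P' [Nt (E K)] ps w" "lparse P' [Nt (E K)] ps' w" "K \<in> Q" for w K ps ps'
    using that
  proof (induction w arbitrary: K ps ps' rule: length_induct)
    case (1 w)
    have IH: "qs = qs'" if "length w' < length w" "lparse P' [Nt (E K')] qs w'" "lparse P' [Nt (E K')] qs' w'"
        "K' \<in> Q" for w' K' qs qs' using 1(1) that by blast
    have hd_block: "l @ v \<noteq> x # v'" "l @ v \<noteq> []" if l: "l \<in> L" "x \<in> X" for l v x v'
    proof -
      obtain y l' where "l = y # l'" "y \<in> Y" using l(1) LY by (cases l) auto
      then show "l @ v \<noteq> x # v'" "l @ v \<noteq> []" using l(2) XY by auto
    qed
    from 1(2)[unfolded parse[OF 1(4)]] show ?case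
    proof (elim disjE bexE exE conjE)
      fix x w' qs
      assume *: "x \<in> X" "w = x # w'" "ps = (E K, [Tm x, Nt (E (lquot [x] K))]) # qs"
        "lparse P' [Nt (E (lquot [x] K))] qs w'"
      from 1(3)[unfolded parse[OF 1(4)]] show ?thesis
      proof (elim disjE bexE exE conjE)
        fix x' w'' qs'
        assume "x' \<in> X" "w = x' # w''" "ps' = (E K, [Tm x', Nt (E (lquot [x'] K))]) # qs'"
          "lparse P' [Nt (E (lquot [x'] K))] qs' w''"
        then show ?thesis using * IH[of w' "lquot [x] K" qs qs'] Q_lquot[OF 1(4), of "[x]"] by simp
      next
        fix l x' w''
        assume "l \<in> L" "w = l @ x' # w''"
        then show ?thesis using hd_block(1)[OF _ *(1)] *(2) by metis
      qed (simp add: *(2))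
    next
      fix l x w' rs qs
      assume *: "l \<in> L" "x \<in> X" "w = l @ x # w'"
        "ps = (E K, [Nt (2 * S + 1), Tm x, Nt (E (lquot (l0 @ [x]) K))]) # map odd_prod rs @ qs"
        "lparse P [Nt S] rs l" "lparse P' [Nt (E (lquot (l0 @ [x]) K))] qs w'"
      from 1(3)[unfolded parse[OF 1(4)]] show ?thesis
      proof (elim disjE bexE exE conjE)
        fix x' w''
        assume "x' \<in> X" "w = x' # w''"
        then show ?thesis using hd_block(1)[OF *(1)] *(3) by metis
      next
        fix l' x' w'' rs' qs'
        assume **: "l' \<in> L" "x' \<in> X" "w = l' @ x' # w''"
          "ps' = (E K, [Nt (2 * S + 1), Tm x', Nt (E (lquot (l0 @ [x']) K))]) # map odd_prod rs' @ qs'"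
          "lparse P [Nt S] rs' l'" "lparse P' [Nt (E (lquot (l0 @ [x']) K))] qs' w''"
        have "l \<in> lists Y" "l' \<in> lists Y" using LY *(1) **(1) by auto
        then have e: "l' = l" "x' = x" "w'' = w'"
          using block_append_eq[OF XY, of l l' x x' w' w''] * ** by auto
        have "rs = rs'" using L_unique *(5) **(5) e by blast
        moreover have "qs = qs'"
          by (rule IH[of w' "lquot (l0 @ [x]) K"]) (use * ** e Q_lquot[OF 1(4)] in simp_all)
        ultimately show ?thesis using *(4) **(4) e by simp
      next
        assume "w = []"
        then show ?thesis using *(3) by simp
      qed
    next
      assume *: "w = []" "ps = [(E K, [])]"
      from 1(3)[unfolded parse[OF 1(4)]] show ?thesis
        by (elim disjE bexE exE conjE) (simp_all add: *)
    qed
  qed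
  show ?thesis
    unfolding unambiguous_cfl_iff_lparse
    using \<open>finite P'\<close> complete[OF _ _ WQ] sound[OF _ WQ] unique[OF _ _ WQ]
    by (intro exI[of _ P'] exI[of _ "E W"]) blast
qed

section \<open>Chains as successions of overlaps\<close>

text \<open>The words that complete an occurrence of a word of \<open>M\<close> begun inside \<open>t\<close>. If \<open>t\<close> is the tail of a
  chain, the minimal ones among them are the possible next tails.\<close>

definition overlap :: "'a list set \<Rightarrow> 'a list \<Rightarrow> 'a list set" where
  "overlap M t = {u. \<exists>x. x \<noteq> [] \<and> suffix x t \<and> x @ u \<in> M}"

definition min_exts :: "'a list set \<Rightarrow> 'a list set" where
  "min_exts A = {u \<in> A. u \<noteq> [] \<and> (\<forall>u1. u1 \<noteq> [] \<longrightarrow> strict_prefix u1 u \<longrightarrow> u1 \<notin> A)}"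

text \<open>Chains with a tail, as a relation between a chain and its tail that forgets the prefix chain.
  A chain from \<open>M\<close> itself counts as its own tail, instead of its part after the first letter. This lets an
  automaton start in the same way as it goes on. It makes no difference for an antichain: the
  only additional overlap is the empty word, which \<open>min_exts\<close> disregards.\<close>

primrec tail_of_chain :: "'a list set \<Rightarrow> nat \<Rightarrow> 'a list \<Rightarrow> 'a list \<Rightarrow> bool" where
  "tail_of_chain M 0 w t \<longleftrightarrow> w \<in> M \<and> t = w"
| "tail_of_chain M (Suc n) w t \<longleftrightarrow>
    (\<exists>w0 t0. w = w0 @ t \<and> tail_of_chain M n w0 t0 \<and> t \<in> min_exts (overlap M t0))"

lemma overlap_Nil [simp]: "overlap M [] = {}"
  by (auto simp: overlap_def)

lemma overlap_snoc: "overlap M (t @ [a]) = lquot [a] (M \<union> overlap M t)"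
proof (intro equalityI subsetI)
  fix u
  assume "u \<in> overlap M (t @ [a])"
  then obtain x where "x \<noteq> []" "suffix x (t @ [a])" "x @ u \<in> M" unfolding overlap_def by blast
  then obtain x' where "suffix x' t" "x = x' @ [a]" by (auto simp: suffix_snoc)
  with \<open>x @ u \<in> M\<close> have "suffix x' t" "x' @ [a] @ u \<in> M" by simp_all
  then show "u \<in> lquot [a] (M \<union> overlap M t)" by (cases "x' = []") (auto simp: overlap_def)
next
  fix u
  assume "u \<in> lquot [a] (M \<union> overlap M t)"
  then have "\<exists>x'. suffix x' t \<and> x' @ [a] @ u \<in> M"
    by (cases "[a] @ u \<in> M") (auto simp: overlap_def intro: exI[of _ "[]"])
  then obtain x' where "suffix x' t" "x' @ [a] @ u \<in> M" by blast
  then have "x' @ [a] \<noteq> []" "suffix (x' @ [a]) (t @ [a])" "(x' @ [a]) @ u \<in> M" by simp_all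
  then show "u \<in> overlap M (t @ [a])" unfolding overlap_def by blast
qed

lemma antichain_prefixD: "antichain M \<Longrightarrow> p \<in> M \<Longrightarrow> q \<in> M \<Longrightarrow> prefix p q \<Longrightarrow> p = q"
  unfolding antichain_def by blast

text \<open>Because the occurrence of \<open>M\<close> starts inside the tail, the prefix chain is irrelevant.\<close>

lemma chain_exts_iff:
  "(w, u) \<in> chain_exts M C \<longleftrightarrow> (\<exists>s t. (s, t) \<in> C \<and> w = s @ t \<and> u \<in> overlap M t)"
proof
  assume "(w, u) \<in> chain_exts M C"
  then obtain s t w' v where *: "(s, t) \<in> C" "w = s @ t" "w' \<in> M" "w @ u = v @ w'"
    "length u < length w'" "length s \<le> length v" unfolding chain_exts_def by blast
  obtain v' where v: "v = s @ v'" using *(2,4,6)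
    by (auto simp: append_eq_append_conv2)
  then have e: "t @ u = v' @ w'" using * by simp
  then obtain x where x: "t = v' @ x" "w' = x @ u"
    using *(5) by (auto simp: append_eq_append_conv2)
  then have "u \<in> overlap M t" using *(3,5) unfolding overlap_def by (auto simp: suffix_def)
  then show "\<exists>s t. (s, t) \<in> C \<and> w = s @ t \<and> u \<in> overlap M t" using * by blast
next
  assume "\<exists>s t. (s, t) \<in> C \<and> w = s @ t \<and> u \<in> overlap M t"
  then obtain s t x v where "(s, t) \<in> C" "w = s @ t" "x \<noteq> []" "t = v @ x" "x @ u \<in> M"
    unfolding overlap_def suffix_def by blast
  then show "(w, u) \<in> chain_exts M C"
    unfolding chain_exts_def
    by (intro CollectI case_prodI exI[of _ s] exI[of _ t] conjI bexI[of _ "x @ u"] exI[of _ "s @ v"]) auto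
qed

lemma min_exts_prefixD:
  assumes "t \<in> min_exts A" "t' \<in> min_exts A" "prefix t t'"
  shows "t = t'"
  using assms unfolding min_exts_def by (auto simp: strict_prefix_def)

text \<open>Chains of the same index form a prefix code: of two comparable ones the prefix chains are
  comparable, hence equal, and then the tails are two minimal elements of one set.\<close>

lemma tail_of_chain_unique:
  assumes "antichain M"
  shows "tail_of_chain M n w t \<Longrightarrow> tail_of_chain M n w' t' \<Longrightarrow> prefix w w' \<Longrightarrow> w = w' \<and> t = t'"
proof (induction n arbitrary: w t w' t')
  case 0
  then show ?case using antichain_prefixD[OF assms] by auto
next
  case (Suc n)
  then obtain w0 t0 w0' t0' where
    *: "w = w0 @ t" "tail_of_chain M n w0 t0" "t \<in> min_exts (overlap M t0)"
       "w' = w0' @ t'" "tail_of_chain M n w0' t0'" "t' \<in> min_exts (overlap M t0')" by auto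
  have "prefix w0 w0' \<or> prefix w0' w0" using Suc.prems(3) *(1,4)
    by (meson append_prefixD prefix_same_cases prefixI)
  then have e: "w0 = w0'" "t0 = t0'" using Suc.IH *(2,5) by blast+
  then have "prefix t t'" using Suc.prems(3) *(1,4) by simp
  then show ?case using * e min_exts_prefixD by blast
qed

lemma Nil_notin_overlap:
  assumes "antichain M" "p @ t \<in> M" "p \<noteq> []"
  shows "[] \<notin> overlap M t"
proof
  assume "[] \<in> overlap M t"
  then obtain x where x: "suffix x t" "x \<in> M" unfolding overlap_def by auto
  then have "suffix x (p @ t)" by (simp add: suffix_appendI)
  then have "x = p @ t" using assms(1,2) x unfolding antichain_def by blast
  then show False using x(1) assms(3) by (auto simp: suffix_def)
qed

text \<open>The clause on overlaps is the induction invariant: whatever the two notions call the tail, the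
  next tails are the same.\<close>

lemma chain_pairs_iff_tail_of_chain:
  assumes M: "antichain M" "[] \<notin> M"
  shows "(s, t) \<in> chain_pairs M n \<Longrightarrow>
      \<exists>t'. tail_of_chain M n (s @ t) t' \<and> overlap M t = overlap M t' - {[]}"
    and "tail_of_chain M n w t' \<Longrightarrow>
      \<exists>s t. (s, t) \<in> chain_pairs M n \<and> w = s @ t \<and> overlap M t = overlap M t' - {[]}"
proof (induction n arbitrary: s t w t')
  case 0
  have first: "overlap M t = overlap M (a # t) - {[]}" if at: "a # t \<in> M" for a t
  proof -
    have "u = []" if "a # t @ u \<in> M" for u
      using antichain_prefixD[OF M(1) at that] by simp
    then have "overlap M (a # t) \<subseteq> overlap M t \<union> {[]}"
      unfolding overlap_def by (auto simp: suffix_Cons)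
    moreover have "overlap M t \<subseteq> overlap M (a # t)"
      unfolding overlap_def by (auto simp: suffix_Cons)
    moreover have "[] \<notin> overlap M t" using Nil_notin_overlap[OF M(1), of "[a]" t] at by simp
    ultimately show ?thesis by blast
  qed
  {
    case 1
    then show ?case using first by auto
  next
    case (2 w t')
    then obtain a t where "w = a # t" using M(2) by (cases w) auto
    then show ?case using 2 first by (intro exI[of _ "[a]"] exI[of _ t]) auto
  }
next
  have not_Nil: "[] \<notin> overlap M u" if "u \<in> overlap M t" for t u
    using that Nil_notin_overlap[OF M(1)] unfolding overlap_def[of _ t] by blast
  case (Suc n)
  {
    case 1
    then have "(s, t) \<in> chain_exts M (chain_pairs M n)"
      and min: "\<And>u1. strict_prefix u1 t \<Longrightarrow> (s, u1) \<notin> chain_exts M (chain_pairs M n)"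
      by (auto simp: minimal_exts_def)
    then obtain s0 t0 where *: "(s0, t0) \<in> chain_pairs M n" "s = s0 @ t0" "t \<in> overlap M t0"
      unfolding chain_exts_iff by blast
    obtain t0' where **: "tail_of_chain M n s t0'" "overlap M t0 = overlap M t0' - {[]}"
      using Suc.IH(1)[OF *(1)] *(2) by blast
    have "u1 \<notin> overlap M t0" if "strict_prefix u1 t" for u1
      using min[OF that] * unfolding chain_exts_iff by blast
    then have "t \<in> min_exts (overlap M t0')"
      using *(3) ** unfolding min_exts_def by auto
    then have "tail_of_chain M (Suc n) (s @ t) t" using ** by auto
    moreover have "[] \<notin> overlap M t" using not_Nil *(3) .
    ultimately show ?case by (intro exI[of _ t]) auto
  next
    case (2 w t')
    then obtain w0 t0' where *: "w = w0 @ t'" "tail_of_chain M n w0 t0'"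
      "t' \<in> min_exts (overlap M t0')" by auto
    obtain s t0 where **: "(s, t0) \<in> chain_pairs M n" "w0 = s @ t0"
      "overlap M t0 = overlap M t0' - {[]}" using Suc.IH(2)[OF *(2)] by blast
    have t': "t' \<in> overlap M t0" using *(3) **(3) unfolding min_exts_def by auto
    have "(w0, u1) \<notin> chain_exts M (chain_pairs M n)" if "strict_prefix u1 t'" for u1
    proof
      assume "(w0, u1) \<in> chain_exts M (chain_pairs M n)"
      then obtain s1 t1 where s1: "(s1, t1) \<in> chain_pairs M n" "w0 = s1 @ t1" "u1 \<in> overlap M t1"
        unfolding chain_exts_iff by blast
      obtain t1' where "tail_of_chain M n w0 t1'" "overlap M t1 = overlap M t1' - {[]}"
        using Suc.IH(1)[OF s1(1)] s1(2) by blast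
      moreover from this have "t1' = t0'" using tail_of_chain_unique[OF M(1)] *(2) by blast
      ultimately show False using s1(3) that *(3) unfolding min_exts_def by auto
    qed
    moreover have "(w0, t') \<in> chain_exts M (chain_pairs M n)"
      unfolding chain_exts_iff using t' ** by blast
    ultimately have "(w0, t') \<in> chain_pairs M (Suc n)" by (auto simp: minimal_exts_def)
    moreover have "[] \<notin> overlap M t'" using not_Nil t' .
    ultimately show ?case using *(1) by (intro exI[of _ w0] exI[of _ t']) auto
  }
qed

definition chain_words :: "'a list set \<Rightarrow> nat \<Rightarrow> 'a list set" where
  "chain_words M n = {s @ t | s t. (s, t) \<in> chain_pairs M n}"

lemma chain_words_iff:
  assumes "antichain M" "[] \<notin> M"
  shows "w \<in> chain_words M n \<longleftrightarrow> (\<exists>t. tail_of_chain M n w t)"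
proof
  assume "w \<in> chain_words M n"
  then obtain s t where "w = s @ t" "(s, t) \<in> chain_pairs M n" unfolding chain_words_def by blast
  with chain_pairs_iff_tail_of_chain(1)[OF assms, of s t n] show "\<exists>t. tail_of_chain M n w t" by auto
next
  assume "\<exists>t. tail_of_chain M n w t"
  then obtain t' where "tail_of_chain M n w t'" by blast
  from chain_pairs_iff_tail_of_chain(2)[OF assms this] show "w \<in> chain_words M n"
    unfolding chain_words_def by auto
qed

section \<open>A finite automaton for chains\<close>

text \<open>The automaton that finds the tails of a word one after the other. In a state \<open>(j, A, B)\<close> the
  number \<open>j\<close> counts the tails before the current one, \<open>A\<close> contains the words which complete an occurrence of \<open>M\<close>
  begun in the previous tail, and \<open>B\<close> those which complete an occurrence begun since. When \<open>A\<close>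
  contains the empty word, a tail ends here. The change to the next tail is postponed to
  the next letter, so that the states in which a chain has just been read remain recognizable. The
  counter stops at \<open>N\<close>, which makes the set of reachable states finite.\<close>

type_synonym 'a chain_state = "nat \<times> 'a list set \<times> 'a list set"

fun reset :: "nat \<Rightarrow> 'a chain_state \<Rightarrow> 'a chain_state" where
  "reset N (j, A, B) = (if [] \<in> A then (min (Suc j) N, B, {}) else (j, A, B))"

fun read :: "'a list set \<Rightarrow> 'a \<Rightarrow> 'a chain_state \<Rightarrow> 'a chain_state" where
  "read M a (j, A, B) = (j, lquot [a] A, lquot [a] (M \<union> B))"

definition run :: "'a list set \<Rightarrow> nat \<Rightarrow> 'a chain_state \<Rightarrow> 'a list \<Rightarrow> 'a chain_state" where
  "run M N = foldl (\<lambda>s a. read M a (reset N s))"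

lemma run_simps [simp]:
  "run M N s [] = s" "run M N s (a # w) = run M N (read M a (reset N s)) w"
  "run M N s (u @ v) = run M N (run M N s u) v"
  by (simp_all add: run_def)

text \<open>From the beginning of a tail until the first moment at which it can end, the automaton only
  takes quotients.\<close>

lemma run_tail:
  assumes "\<forall>u1. u1 \<noteq> [] \<longrightarrow> strict_prefix u1 (a # u) \<longrightarrow> u1 \<notin> A"
  shows "run M N (read M a (j, A, {})) u = (j, lquot (a # u) A, overlap M (a # u))"
  using assms
proof (induction u rule: rev_induct)
  case Nil
  then show ?case using overlap_snoc[of M "[]" a] by simp
next
  case (snoc b u)
  have "u1 \<notin> A" if "u1 \<noteq> []" "strict_prefix u1 (a # u)" for u1
    using snoc.prems that by (metis append_Cons prefix_order.less_le_trans prefixI)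
  moreover have "a # u \<notin> A" using snoc.prems[rule_format, of "a # u"] by (simp add: strict_prefix_def)
  ultimately show ?case using snoc.IH overlap_snoc[of M "a # u" b] by simp
qed

lemma run_chain:
  assumes M: "antichain M" "[] \<notin> M" and "n < N" "tail_of_chain M n w t"
  shows "\<exists>A. run M N (0, M, {}) w = (n, A, overlap M t) \<and> [] \<in> A"
  using assms(3,4)
proof (induction n arbitrary: w t)
  case 0
  then obtain a u where "w = a # u" "a # u \<in> M" "t = w" using M(2) by (cases w) auto
  moreover from this have "\<forall>u1. u1 \<noteq> [] \<longrightarrow> strict_prefix u1 (a # u) \<longrightarrow> u1 \<notin> M"
    using antichain_prefixD[OF M(1)] by (auto simp: strict_prefix_def)
  ultimately show ?case using run_tail[of a u M M N 0] M(2) by auto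
next
  case (Suc n)
  then obtain w0 t0 where *: "w = w0 @ t" "tail_of_chain M n w0 t0" "t \<in> min_exts (overlap M t0)" by auto
  then obtain a u where t: "t = a # u" by (cases t) (auto simp: min_exts_def)
  obtain A where "run M N (0, M, {}) w0 = (n, A, overlap M t0)" "[] \<in> A"
    using Suc.IH[OF _ *(2)] Suc.prems(1) by auto
  then show ?case
    using *(1,3) t Suc.prems(1) run_tail[of a u "overlap M t0" M N "Suc n"] by (auto simp: min_exts_def)
qed

text \<open>Here \<open>w0\<close> is the part of the word up to the last completed chain, \<open>u\<close> the part read since, and \<open>A0\<close>
  the value of \<open>A\<close> when the reading of \<open>u\<close> began.\<close>

lemma run_invariant:
  assumes "[] \<notin> M" "run M N (0, M, {}) w = (j, A, B)" "j < N"
  shows "\<exists>w0 u A0. w = w0 @ u \<and> A = lquot u A0 \<and> B = overlap M u \<and>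
    (\<forall>u1. u1 \<noteq> [] \<longrightarrow> strict_prefix u1 u \<longrightarrow> u1 \<notin> A0) \<and>
    (w0 = [] \<and> j = 0 \<and> A0 = M \<or>
     u \<noteq> [] \<and> (\<exists>i t0. j = Suc i \<and> tail_of_chain M i w0 t0 \<and> A0 = overlap M t0))"
  using assms(2,3)
proof (induction w arbitrary: j A B rule: rev_induct)
  case Nil
  then show ?case by (intro exI[of _ "[]"] exI[of _ M]) auto
next
  case (snoc a w)
  obtain j' A' B' where r: "run M N (0, M, {}) w = (j', A', B')" by (cases "run M N (0, M, {}) w") auto
  have e: "(j, A, B) = read M a (reset N (j', A', B'))" using snoc.prems(1) r by simp
  then have "j' < N" using snoc.prems(2) by (auto split: if_splits)
  from snoc.IH[OF r this] obtain w0 u A0 where IH: "w = w0 @ u" "A' = lquot u A0" "B' = overlap M u"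
    "\<forall>u1. u1 \<noteq> [] \<longrightarrow> strict_prefix u1 u \<longrightarrow> u1 \<notin> A0"
    "w0 = [] \<and> j' = 0 \<and> A0 = M \<or>
     u \<noteq> [] \<and> (\<exists>i t0. j' = Suc i \<and> tail_of_chain M i w0 t0 \<and> A0 = overlap M t0)" by blast
  show ?case
  proof (cases "u \<in> A0")
    case True
    then have tail: "tail_of_chain M j' w u" using IH assms(1) by (auto simp: min_exts_def)
    have new: "j = Suc j'" "A = lquot [a] B'" "B = overlap M [a]"
      using e True IH(2) snoc.prems(2) overlap_snoc[of M "[]" a] by auto
    have "\<exists>i t0. j = Suc i \<and> tail_of_chain M i w t0 \<and> B' = overlap M t0"
      using tail new(1) IH(3) by blast
    moreover have "\<forall>u1. u1 \<noteq> [] \<longrightarrow> strict_prefix u1 [a] \<longrightarrow> u1 \<notin> B'"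
      by (simp add: strict_prefix_def prefix_Cons)
    ultimately show ?thesis using new(2,3)
      by (intro exI[of _ w] exI[of _ "[a]"] exI[of _ B'] conjI disjI2) simp_all
  next
    case False
    then have new: "j = j'" "A = lquot (u @ [a]) A0" "B = overlap M (u @ [a])"
      using e IH(2,3) overlap_snoc[of M u a] by auto
    moreover have "\<forall>u1. u1 \<noteq> [] \<longrightarrow> strict_prefix u1 (u @ [a]) \<longrightarrow> u1 \<notin> A0"
      using IH(4) False by (metis prefix_snoc strict_prefix_def)
    moreover have "w0 = [] \<and> j = 0 \<and> A0 = M \<or>
        u @ [a] \<noteq> [] \<and> (\<exists>i t0. j = Suc i \<and> tail_of_chain M i w0 t0 \<and> A0 = overlap M t0)"
      using IH(5) new(1) by blast
    moreover have "w @ [a] = w0 @ u @ [a]" using IH(1) by simp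
    ultimately show ?thesis by blast
  qed
qed

lemma chain_words_iff_run:
  assumes M: "antichain M" "[] \<notin> M" and "n < N"
  shows "w \<in> chain_words M n \<longleftrightarrow> (\<exists>A B. run M N (0, M, {}) w = (n, A, B) \<and> [] \<in> A)"
proof
  show "\<exists>A B. run M N (0, M, {}) w = (n, A, B) \<and> [] \<in> A" if "w \<in> chain_words M n"
    using run_chain[OF M \<open>n < N\<close>] that unfolding chain_words_iff[OF M] by blast
next
  assume "\<exists>A B. run M N (0, M, {}) w = (n, A, B) \<and> [] \<in> A"
  then obtain A B where r: "run M N (0, M, {}) w = (n, A, B)" and "[] \<in> A" by blast
  with run_invariant[OF M(2) r \<open>n < N\<close>] obtain w0 u A0 where *: "w = w0 @ u" "A = lquot u A0"
    "\<forall>u1. u1 \<noteq> [] \<longrightarrow> strict_prefix u1 u \<longrightarrow> u1 \<notin> A0"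
    "w0 = [] \<and> n = 0 \<and> A0 = M \<or>
     u \<noteq> [] \<and> (\<exists>i t0. n = Suc i \<and> tail_of_chain M i w0 t0 \<and> A0 = overlap M t0)" by blast
  have "u \<in> A0" using \<open>[] \<in> A\<close> *(2) by simp
  with * M(2) have "tail_of_chain M n w u" by (auto simp: min_exts_def)
  then show "w \<in> chain_words M n" unfolding chain_words_iff[OF M] by blast
qed

text \<open>The possible values of \<open>A\<close> and \<open>B\<close>.\<close>

definition residual_unions :: "'a list set \<Rightarrow> 'a list set set" where
  "residual_unions M = {K. \<exists>U. K = (\<Union>u\<in>U. lquot u M)}"

lemma residual_unionsI: "(\<Union>u\<in>U. lquot u M) \<in> residual_unions M"
  unfolding residual_unions_def by blast

lemma finite_residual_unions:
  assumes "finite_index M"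
  shows "finite (residual_unions M)"
proof -
  have "residual_unions M \<subseteq> Union ` Pow (range (\<lambda>u. lquot u M))"
    unfolding residual_unions_def by blast
  then show ?thesis using assms unfolding finite_index_def by (meson finite_Pow_iff finite_imageI finite_subset)
qed

lemma residual_unions_closed:
  shows "{} \<in> residual_unions M" "M \<in> residual_unions M"
    and "K \<in> residual_unions M \<Longrightarrow> lquot v K \<in> residual_unions M"
    and "K \<in> residual_unions M \<Longrightarrow> K' \<in> residual_unions M \<Longrightarrow> K \<union> K' \<in> residual_unions M"
proof -
  show "{} \<in> residual_unions M" using residual_unionsI[where U = "{}"] by simp
  show "M \<in> residual_unions M" using residual_unionsI[where U = "{[]}"] by simp
  show "lquot v K \<in> residual_unions M" if "K \<in> residual_unions M"
  proof -
    from that obtain U where "K = (\<Union>u\<in>U. lquot u M)" unfolding residual_unions_def by blast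
    then have "lquot v K = (\<Union>u\<in>(\<lambda>u. u @ v) ` U. lquot u M)" by auto
    then show ?thesis using residual_unionsI by metis
  qed
  show "K \<union> K' \<in> residual_unions M" if "K \<in> residual_unions M" "K' \<in> residual_unions M"
    using that unfolding residual_unions_def by (auto intro: exI[of _ "_ \<union> _"] simp flip: UN_Un)
qed

definition chain_states :: "'a list set \<Rightarrow> nat \<Rightarrow> 'a chain_state set" where
  "chain_states M N = {..N} \<times> residual_unions M \<times> residual_unions M"

lemma read_reset_closed: "s \<in> chain_states M N \<Longrightarrow> read M a (reset N s) \<in> chain_states M N"
  by (cases s) (auto simp: chain_states_def residual_unions_closed)

lemma run_closed: "s \<in> chain_states M N \<Longrightarrow> run M N s w \<in> chain_states M N"
  by (induction w arbitrary: s) (simp_all add: read_reset_closed del: read.simps reset.simps)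

lemma run_initial_closed: "run M N (0, M, {}) w \<in> chain_states M N"
  by (rule run_closed) (simp add: chain_states_def residual_unions_closed)

lemma finite_index_chain_words:
  assumes M: "antichain M" "[] \<notin> M" and "finite_index M"
  shows "finite_index (chain_words M n)"
proof -
  define N where "N = Suc n"
  then have "lquot u (chain_words M n) =
      (\<lambda>s. {w. \<exists>A B. run M N s w = (n, A, B) \<and> [] \<in> A}) (run M N (0, M, {}) u)" for u
    using chain_words_iff_run[OF M, of n N] by auto
  then have "range (\<lambda>u. lquot u (chain_words M n)) \<subseteq>
      (\<lambda>s. {w. \<exists>A B. run M N s w = (n, A, B) \<and> [] \<in> A}) ` chain_states M N"
    using run_initial_closed by blast
  moreover have "finite (chain_states M N)"
    unfolding chain_states_def using finite_residual_unions[OF \<open>finite_index M\<close>] by simp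
  ultimately show ?thesis unfolding finite_index_def by (rule finite_subset[OF _ finite_imageI])
qed

text \<open>Once a letter of \<open>Y\<close> has been read, no further letter of \<open>Y\<close> changes the state. For the quotients this
  is the invariance of \<open>M\<close>. The occurrences begun at the later letters add nothing to \<open>B\<close>, as
  their residuals agree with that of the occurrence begun at the first one. No tail
  ends within the block since no word of \<open>M\<close> ends in \<open>Y\<close>.\<close>

lemma block_invariant_chain_words:
  assumes M: "antichain M" "[] \<notin> M" and inv: "block_invariant Y M"
    and last: "\<And>w. w \<in> M \<Longrightarrow> last w \<notin> Y"
  shows "block_invariant Y (chain_words M n)"
proof -
  define N where "N = Suc n"
  have block: "lquot l K = lquot l' K"
    if "K \<in> residual_unions M" "l \<in> lists Y - {[]}" "l' \<in> lists Y - {[]}" for K l l'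
    using that inv unfolding residual_unions_def block_invariant_def by (auto simp: set_eq_iff) blast+
  have not_last: "[y] \<notin> K" if "K \<in> residual_unions M" "y \<in> Y" for K y
    using that last unfolding residual_unions_def by fastforce
  have once: "read M y' (reset N (read M y (reset N s))) = read M y (reset N s)"
    and same: "read M y' (reset N s) = read M y (reset N s)"
    if s: "s \<in> chain_states M N" and y: "y \<in> Y" "y' \<in> Y" for s y y'
  proof -
    obtain j A B where r: "reset N s = (j, A, B)" by (cases "reset N s") auto
    then have AB: "A \<in> residual_unions M" "B \<in> residual_unions M"
      using s by (cases s, auto simp: chain_states_def residual_unions_closed split: if_splits)+
    have M': "M \<in> residual_unions M" by (rule residual_unions_closed)
    have eqs: "lquot [y'] K = lquot [y] K" "lquot [y, y'] K = lquot [y] K" if "K \<in> residual_unions M" for K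
      using block[OF that] y by simp_all
    have MB: "M \<union> B \<in> residual_unions M" using residual_unions_closed(4)[OF M' AB(2)] .
    have u: "lquot v (K \<union> K') = lquot v K \<union> lquot v K'" for v and K K' :: "'a list set" by auto
    show "read M y' (reset N s) = read M y (reset N s)" using r eqs[OF AB(1)] eqs[OF MB] by simp
    show "read M y' (reset N (read M y (reset N s))) = read M y (reset N s)"
      using r not_last[OF AB(1) y(1)] eqs[OF AB(1)] eqs[OF AB(2)] eqs[OF M'] by (auto simp: u)
  qed
  have block_run: "run M N s (y # l) = read M y (reset N s)"
    if "s \<in> chain_states M N" "y \<in> Y" "l \<in> lists Y" for s y l
    using that(3)
  proof (induction l)
    case (Cons y' l)
    then show ?case using once[OF that(1,2), of y'] by simp
  qed simp
  have swap: "run M N s l = run M N s l'"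
    if s: "s \<in> chain_states M N" and l: "l \<in> lists Y - {[]}" "l' \<in> lists Y - {[]}" for s l l'
  proof -
    obtain y k y' k' where "l = y # k" "l' = y' # k'" using l by (cases l; cases l') auto
    then show ?thesis using l block_run[OF s, of y k] block_run[OF s, of y' k']
        same[OF s, of y y'] by simp
  qed
  show ?thesis
    unfolding block_invariant_def
  proof (intro ballI allI impI)
    fix l l' u w
    assume l: "l \<in> lists Y - {[]}" "l' \<in> lists Y - {[]}" and "u @ l @ w \<in> chain_words M n"
    have "run M N (0, M, {}) (u @ l @ w) = run M N (0, M, {}) (u @ l' @ w)"
      using swap[OF run_initial_closed l, of u] by simp
    moreover have "n < N" unfolding N_def by simp
    ultimately show "u @ l' @ w \<in> chain_words M n"
      using \<open>u @ l @ w \<in> chain_words M n\<close> unfolding chain_words_iff_run[OF M \<open>n < N\<close>] by simp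
  qed
qed

section \<open>Chains whose blocks lie in a given language\<close>

lemma last_chain_pairs:
  assumes ends: "\<And>w. w \<in> M \<Longrightarrow> w \<noteq> [] \<and> hd w \<in> X \<and> last w \<in> X"
  shows "(s, t) \<in> chain_pairs M n \<Longrightarrow> s \<noteq> [] \<and> last s \<in> X \<and> last (s @ t) \<in> X"
proof (induction n arbitrary: s t)
  case 0
  then show ?case using ends by fastforce
next
  case (Suc n)
  then obtain s0 t0 where *: "(s0, t0) \<in> chain_pairs M n" "s = s0 @ t0" "t \<in> overlap M t0"
    by (auto simp: minimal_exts_def chain_exts_iff)
  then obtain x where "x \<noteq> []" "suffix x t0" "x @ t \<in> M" unfolding overlap_def by blast
  then have "last (s @ t) \<in> X" using ends[of "x @ t"] *(2) by (auto simp: suffix_def)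
  then show ?case using Suc.IH[OF *(1)] *(2) by auto
qed

text \<open>The word of \<open>M\<close> that a new tail completes begins with a letter of \<open>X\<close>, so its part inside the old
  tail belongs to \<open>blocks X L\<close> with the old tail, and then all of it does if and only if the new tail does. Minimality is not affected by restricting to \<open>blocks X L\<close>, because
  a shorter extension is a prefix that ends with a letter of \<open>X\<close>.\<close>

lemma chain_pairs_Int_blocks:
  assumes XY: "X \<inter> Y = {}" and LY: "L \<subseteq> lists Y - {[]}"
    and ends: "\<And>w. w \<in> M \<Longrightarrow> w \<noteq> [] \<and> hd w \<in> X \<and> last w \<in> X"
  shows "chain_pairs (M \<inter> blocks X L) n = chain_pairs M n \<inter> blocks X L \<times> blocks X L"
proof (induction n)
  case 0
  have "a # t \<in> blocks X L \<longleftrightarrow> [a] \<in> blocks X L \<and> t \<in> blocks X L" if "a # t \<in> M" for a t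
    using blocks_letter_iff[OF XY LY, of a] ends[OF that] by (auto intro: blocks.intros)
  then show ?case by auto
next
  case (Suc n)
  let ?B = "blocks X L"
  have overlap_blocks: "u \<in> overlap (M \<inter> ?B) t \<longleftrightarrow> u \<in> overlap M t \<and> u \<in> ?B" if t: "t \<in> ?B" for t u
  proof -
    have "x @ u \<in> ?B \<longleftrightarrow> u \<in> ?B" if "x \<noteq> []" "suffix x t" "x @ u \<in> M" for x
    proof -
      have "x \<in> ?B" using blocks_suffix[OF XY LY, of _ x] t that ends[OF that(3)] by (auto simp: suffix_def)
      then show ?thesis using blocks_append blocks_cancel[OF XY LY] by blast
    qed
    then show ?thesis unfolding overlap_def by blast
  qed
  have split: "s \<in> ?B \<and> t \<in> ?B \<longleftrightarrow> s @ t \<in> ?B" if "(s, t) \<in> chain_pairs M n" for s t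
    using blocks_append blocks_prefix[OF XY LY, of s t] blocks_cancel[OF XY LY, of s t]
      last_chain_pairs[OF ends that] by blast
  let ?E = "chain_exts M (chain_pairs M n)"
  have E: "chain_exts (M \<inter> ?B) (chain_pairs M n \<inter> ?B \<times> ?B) = ?E \<inter> ?B \<times> ?B"
    using overlap_blocks split by (auto simp: chain_exts_iff) blast+
  have prefix_closed: "u1 \<in> ?B" if u: "u \<in> ?B" "(w, u1) \<in> ?E" "strict_prefix u1 u" for w u u1
  proof -
    from u(2) obtain x where "x @ u1 \<in> M" unfolding chain_exts_iff overlap_def by blast
    then have "u1 = [] \<or> last u1 \<in> X" using ends[of "x @ u1"] by (cases "u1 = []") auto
    moreover obtain v where "u = u1 @ v" using u(3) by (auto simp: strict_prefix_def prefix_def)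
    ultimately show ?thesis using blocks_prefix[OF XY LY] u(1) by blast
  qed
  have "minimal_exts (?E \<inter> ?B \<times> ?B) = minimal_exts ?E \<inter> ?B \<times> ?B"
  proof (intro equalityI subrelI)
    fix w u assume "(w, u) \<in> minimal_exts (?E \<inter> ?B \<times> ?B)"
    then have "(w, u) \<in> ?E" "w \<in> ?B" "u \<in> ?B"
      and min: "\<And>u1. strict_prefix u1 u \<Longrightarrow> u1 \<in> ?B \<Longrightarrow> (w, u1) \<notin> ?E"
      by (auto simp: minimal_exts_def)
    moreover have "(w, u1) \<notin> ?E" if "strict_prefix u1 u" for u1
      using min[OF that] prefix_closed[OF \<open>u \<in> ?B\<close> _ that] by blast
    ultimately show "(w, u) \<in> minimal_exts ?E \<inter> ?B \<times> ?B" by (auto simp: minimal_exts_def)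
  qed (auto simp: minimal_exts_def)
  then show ?case by (simp add: Suc E)
qed

lemma chain_words_Int_blocks:
  assumes "X \<inter> Y = {}" "L \<subseteq> lists Y - {[]}" "\<And>w. w \<in> M \<Longrightarrow> w \<noteq> [] \<and> hd w \<in> X \<and> last w \<in> X"
  shows "chain_words (M \<inter> blocks X L) n = chain_words M n \<inter> blocks X L"
proof -
  have split: "s \<in> blocks X L \<and> t \<in> blocks X L \<longleftrightarrow> s @ t \<in> blocks X L"
    if "(s, t) \<in> chain_pairs M n" for s t
    using blocks_append blocks_prefix[OF assms(1,2), of s t] blocks_cancel[OF assms(1,2), of s t]
      last_chain_pairs[OF assms(3) that] by blast
  have eq: "chain_pairs (M \<inter> blocks X L) n = chain_pairs M n \<inter> blocks X L \<times> blocks X L"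
    by (rule chain_pairs_Int_blocks) (use assms in auto)
  have "w \<in> chain_words (M \<inter> blocks X L) n \<longleftrightarrow>
      (\<exists>s t. w = s @ t \<and> (s, t) \<in> chain_pairs M n \<and> s \<in> blocks X L \<and> t \<in> blocks X L)" for w
    unfolding chain_words_def eq by blast
  moreover have "w \<in> chain_words M n \<longleftrightarrow> (\<exists>s t. w = s @ t \<and> (s, t) \<in> chain_pairs M n)" for w
    unfolding chain_words_def by auto
  ultimately have "w \<in> chain_words (M \<inter> blocks X L) n \<longleftrightarrow> w \<in> chain_words M n \<inter> blocks X L" for w
    unfolding Int_iff using split by metis
  then show ?thesis by blast
qed

section \<open>The minimal basis of a monomial ideal\<close>

lemma free_algebra_simps [simp]:
  "carrier (free_algebra Z) = {p. Poly_Mapping.keys p \<subseteq> lists Z}"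
  "p \<otimes>\<^bsub>free_algebra Z\<^esub> q = p * q" "p \<oplus>\<^bsub>free_algebra Z\<^esub> q = p + q"
  "\<one>\<^bsub>free_algebra Z\<^esub> = 1" "\<zero>\<^bsub>free_algebra Z\<^esub> = 0"
  by (simp_all add: free_algebra_def)

lemma keys_mult_words:
  fixes p q :: "'a list \<Rightarrow>\<^sub>0 'k::field"
  assumes "w \<in> Poly_Mapping.keys (p * q)"
  shows "\<exists>u v. w = u @ v \<and> u \<in> Poly_Mapping.keys p \<and> v \<in> Poly_Mapping.keys q"
  using assms keys_mult[of p q] by (auto simp: plus_list_def)

lemma keys_mult_lists:
  fixes p q :: "'a list \<Rightarrow>\<^sub>0 'k::field"
  assumes "Poly_Mapping.keys p \<subseteq> lists Z" "Poly_Mapping.keys q \<subseteq> lists Z"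
  shows "Poly_Mapping.keys (p * q) \<subseteq> lists Z"
proof
  fix w assume "w \<in> Poly_Mapping.keys (p * q)"
  then obtain u v where "w = u @ v" "u \<in> Poly_Mapping.keys p" "v \<in> Poly_Mapping.keys q"
    using keys_mult_words by blast
  then show "w \<in> lists Z" using assms by auto
qed

lemma ring_free_algebra: "ring (free_algebra Z :: ('a list \<Rightarrow>\<^sub>0 'k::field) ring)"
proof (intro ringI abelian_groupI monoidI, goal_cases)
  case (1 p q)
  then show ?case using keys_add[of p q] by auto
next
  case (6 p)
  then show ?case by (intro bexI[of _ "- p"]) (auto)
next
  case (7 p q)
  then show ?case using keys_mult_lists by simp
next
  case 8
  show ?case by (auto simp: zero_list_def simp flip: single_one)
qed (auto simp: algebra_simps)

text \<open>The words in the monomial ideal generated by \<open>M\<close>.\<close>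

definition multiples :: "'a set \<Rightarrow> 'a list set \<Rightarrow> 'a list set" where
  "multiples Z M = {w \<in> lists Z. \<exists>m\<in>M. sublist m w}"

lemma multiples_sublist:
  "u \<in> multiples Z M \<Longrightarrow> sublist u w \<Longrightarrow> w \<in> lists Z \<Longrightarrow> w \<in> multiples Z M"
  unfolding multiples_def by (blast intro: sublist_order.order_trans)

lemma ideal_multiples:
  "ideal {p :: 'a list \<Rightarrow>\<^sub>0 'k::field. Poly_Mapping.keys p \<subseteq> multiples Z M} (free_algebra Z)"
proof (rule idealI[OF ring_free_algebra])
  let ?J = "{p :: 'a list \<Rightarrow>\<^sub>0 'k. Poly_Mapping.keys p \<subseteq> multiples Z M}"
  interpret R: ring "free_algebra Z :: ('a list \<Rightarrow>\<^sub>0 'k) ring" by (rule ring_free_algebra)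
  show "subgroup ?J (add_monoid (free_algebra Z))"
  proof (rule R.add.subgroupI)
    show "?J \<subseteq> carrier (free_algebra Z)" by (auto simp: multiples_def)
    show "?J \<noteq> {}" by (auto intro: exI[of _ 0])
    fix p assume p: "p \<in> ?J"
    have "\<ominus>\<^bsub>free_algebra Z\<^esub> p = - p"
      using p by (intro R.minus_equality) (auto simp: multiples_def)
    then show "\<ominus>\<^bsub>free_algebra Z\<^esub> p \<in> ?J" using p by simp
    fix q assume "q \<in> ?J"
    then show "p \<oplus>\<^bsub>free_algebra Z\<^esub> q \<in> ?J" using p keys_add[of p q] by auto
  qed
  fix p x :: "'a list \<Rightarrow>\<^sub>0 'k"
  assume p: "p \<in> ?J" and x: "x \<in> carrier (free_algebra Z)"
  have "u @ v \<in> multiples Z M" "v @ u \<in> multiples Z M" if "u \<in> multiples Z M" "v \<in> lists Z" for u v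
    using that multiples_sublist[OF that(1), of "u @ v"] multiples_sublist[OF that(1), of "v @ u"]
    by (auto simp: multiples_def)
  then show "x \<otimes>\<^bsub>free_algebra Z\<^esub> p \<in> ?J" "p \<otimes>\<^bsub>free_algebra Z\<^esub> x \<in> ?J"
    using p x by (auto dest!: keys_mult_words) blast+
qed

lemma word_mon_in_monomial_ideal_gen_iff:
  assumes "M \<subseteq> lists Z"
  shows "(word_mon w :: 'a list \<Rightarrow>\<^sub>0 'k::field) \<in> monomial_ideal_gen Z M \<longleftrightarrow> w \<in> multiples Z M"
proof
  interpret R: ring "free_algebra Z :: ('a list \<Rightarrow>\<^sub>0 'k) ring" by (rule ring_free_algebra)
  let ?gens = "(word_mon :: 'a list \<Rightarrow> 'a list \<Rightarrow>\<^sub>0 'k) ` M"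
  have gens: "?gens \<subseteq> carrier (free_algebra Z)" using assms by (auto simp: word_mon_def)
  show "w \<in> multiples Z M" if "(word_mon w :: 'a list \<Rightarrow>\<^sub>0 'k) \<in> monomial_ideal_gen Z M"
  proof -
    have "?gens \<subseteq> {p. Poly_Mapping.keys p \<subseteq> multiples Z M}"
      using assms by (auto simp: word_mon_def multiples_def)
    then have "Idl\<^bsub>free_algebra Z\<^esub> ?gens \<subseteq> {p. Poly_Mapping.keys p \<subseteq> multiples Z M}"
      by (rule R.genideal_minimal[OF ideal_multiples])
    then show ?thesis using that unfolding monomial_ideal_gen_def by (auto simp: word_mon_def)
  qed
  show "(word_mon w :: 'a list \<Rightarrow>\<^sub>0 'k) \<in> monomial_ideal_gen Z M" if "w \<in> multiples Z M"
  proof -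
    from that obtain m u v where w: "w = u @ m @ v" "m \<in> M" "u \<in> lists Z" "v \<in> lists Z"
      unfolding multiples_def sublist_def by force
    have "ideal (Idl\<^bsub>free_algebra Z\<^esub> ?gens) (free_algebra Z)" by (rule R.genideal_ideal[OF gens])
    then interpret I: ideal "Idl\<^bsub>free_algebra Z\<^esub> ?gens" "free_algebra Z" .
    have "(word_mon m :: 'a list \<Rightarrow>\<^sub>0 'k) \<in> Idl\<^bsub>free_algebra Z\<^esub> ?gens"
      using R.genideal_self[OF gens] w(2) by blast
    moreover have "(word_mon u :: 'a list \<Rightarrow>\<^sub>0 'k) \<in> carrier (free_algebra Z)"
      "(word_mon v :: 'a list \<Rightarrow>\<^sub>0 'k) \<in> carrier (free_algebra Z)"
      using w by (auto simp: word_mon_def)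
    ultimately have "(word_mon u :: 'a list \<Rightarrow>\<^sub>0 'k) * (word_mon m * word_mon v) \<in> Idl\<^bsub>free_algebra Z\<^esub> ?gens"
      using I.I_l_closed I.I_r_closed by (metis free_algebra_simps(2))
    moreover have "(word_mon u :: 'a list \<Rightarrow>\<^sub>0 'k) * (word_mon m * word_mon v) = word_mon w"
      unfolding w(1) word_mon_def by (simp add: mult_single plus_list_def)
    ultimately show ?thesis unfolding monomial_ideal_gen_def by simp
  qed
qed

text \<open>An antichain consists of the minimal elements, for the subword order, among its multiples.\<close>

lemma antichain_determined:
  assumes "antichain M" "antichain M'" "M \<subseteq> lists Z" "M' \<subseteq> lists Z" "multiples Z M = multiples Z M'"
  shows "M \<subseteq> M'"
proof
  fix m assume "m \<in> M"
  then have "m \<in> multiples Z M" using assms(3) by (auto simp: multiples_def)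
  then have "m \<in> multiples Z M'" using assms(5) by simp
  then obtain m' where m': "m' \<in> M'" "sublist m' m" by (auto simp: multiples_def)
  then have "m' \<in> multiples Z M'" using assms(4) by (auto simp: multiples_def)
  then have "m' \<in> multiples Z M" using assms(5) by simp
  then obtain m'' where m'': "m'' \<in> M" "sublist m'' m'" by (auto simp: multiples_def)
  then have "m'' = m" using m'(2) \<open>m \<in> M\<close> assms(1) unfolding antichain_def
    by (meson sublist_order.order_trans)
  then show "m \<in> M'" using m' m'' by (metis sublist_order.order_antisym)
qed

lemma min_basis_monomial_ideal_gen:
  assumes "M \<subseteq> lists Z" "antichain M"
  shows "min_basis Z (monomial_ideal_gen Z M :: ('a list \<Rightarrow>\<^sub>0 'k::field) set) = M"
  unfolding min_basis_def
proof (rule the_equality)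
  fix M' assume M': "M' \<subseteq> lists Z \<and> antichain M' \<and>
    (monomial_ideal_gen Z M' :: ('a list \<Rightarrow>\<^sub>0 'k) set) = monomial_ideal_gen Z M"
  then have "multiples Z M' = multiples Z M"
    using word_mon_in_monomial_ideal_gen_iff[where 'k = 'k] assms(1) by blast
  then show "M' = M" using antichain_determined assms M' by (metis subset_antisym)
qed (use assms in auto)

section \<open>Bases with framed blocks\<close>

text \<open>In a word with a single block an occurrence of a nonempty word over \<open>Y\<close> lies in that block.\<close>

lemma factor_between:
  assumes XY: "X \<inter> Y = {}" and l: "l \<in> lists Y - {[]}" and s: "s \<in> lists X" "s' \<in> lists X"
    and eq: "p @ l @ q = s @ m @ s'"
  shows "\<exists>u v. p = s @ u \<and> q = v @ s' \<and> m = u @ l @ v"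
proof -
  have "\<exists>u. p = s @ u \<and> u @ l @ q = m @ s'"
  proof -
    from eq consider u where "p = s @ u" "u @ l @ q = m @ s'" | u where "s = p @ u" "l @ q = u @ m @ s'"
      by (auto simp: append_eq_append_conv2[of p])
    then show ?thesis
    proof cases
      case 2
      have "u = []"
        using 2 l s XY by (cases u; cases l) auto
      then show ?thesis using 2 by auto
    qed blast
  qed
  then obtain u where u: "p = s @ u" "(u @ l) @ q = m @ s'" by auto
  then consider v where "m = (u @ l) @ v" "q = v @ s'" | v where "u @ l = m @ v" "s' = v @ q"
    unfolding append_eq_append_conv2[of "u @ l"] by auto
  then show ?thesis
  proof cases
    case 2
    have "v = []"
    proof (rule ccontr)
      assume "v \<noteq> []"
      then have "last l = last v" using arg_cong[OF 2(1), of last] l by auto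
      moreover have "last l \<in> Y" "last v \<in> X" using l s(2) 2(2) \<open>v \<noteq> []\<close> by (auto simp: in_lists_conv_set)
      ultimately show False using XY by auto
    qed
    then show ?thesis using 2 u by auto
  qed (use u in auto)
qed

lemma sublist_between:
  assumes XY: "X \<inter> Y = {}" and r: "r \<in> lists X" "r \<noteq> []" and m: "m \<in> lists Y - {[]}"
    and "sublist r (s @ m @ s')"
  shows "sublist r s \<or> sublist r s'"
proof -
  have no_prefix: "x = []" if "prefix x (m @ z)" "x \<in> lists X" for x z
    using that m XY by (cases x; cases m) auto
  have no_suffix: "x = []" if "suffix x m" "x \<in> lists X" for x
  proof (rule ccontr)
    assume "x \<noteq> []"
    then have "last x \<in> set x" "set x \<subseteq> set m" using that(1) by (auto dest: set_mono_suffix)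
    then show False using that(2) m XY by auto
  qed
  have no_sub: "\<not> sublist r m"
    using r m XY set_mono_sublist[of r m] by (cases r) auto
  from assms(5) consider "sublist r s" | "sublist r (m @ s')"
    | x z where "r = x @ z" "suffix x s" "prefix z (m @ s')"
    by (auto simp: sublist_append[of r s])
  then show ?thesis
  proof cases
    case 2
    then consider "sublist r s'" | x z where "r = x @ z" "suffix x m" "prefix z s'"
      using no_sub by (auto simp: sublist_append[of r m])
    then show ?thesis
    proof cases
      case 2
      then show ?thesis using no_suffix[of x] r by auto
    qed blast
  next
    case 3
    then show ?thesis using no_prefix[of z s'] r by auto
  qed blast
qed

text \<open>The hypotheses of the theorem on \<open>R0\<close>, \<open>R i\<close>, \<open>R' i\<close>, with the language between \<open>R i\<close> and \<open>R' i\<close> left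
  open. The proof applies them both to \<open>L\<close> and to the language of all nonempty words over \<open>Y\<close>.\<close>

locale framed_basis =
  fixes X Y :: "'a set" and J :: "'i set" and R0 :: "'a list set" and R R' :: "'i \<Rightarrow> 'a list set"
  assumes XY: "X \<inter> Y = {}"
    and R0: "R0 \<subseteq> lists X - {[]}"
    and R: "\<And>i. i \<in> J \<Longrightarrow> R i \<subseteq> lists X - {[]}"
    and R': "\<And>i. i \<in> J \<Longrightarrow> R' i \<subseteq> lists X - {[]}"
    and R0_disjoint: "\<And>i. i \<in> J \<Longrightarrow> R0 \<inter> R i = {} \<and> R0 \<inter> R' i = {}"
    and R_disjoint: "\<And>i j. i \<in> J \<Longrightarrow> j \<in> J \<Longrightarrow> i \<noteq> j \<Longrightarrow> R i \<inter> R j = {}"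
    and antichain_frames: "antichain (R0 \<union> (\<Union>i\<in>J. R i \<union> R' i))"
begin

definition basis :: "'a list set \<Rightarrow> 'a list set" where
  "basis B = R0 \<union> (\<Union>i\<in>J. R i \<cdot>\<cdot> B \<cdot>\<cdot> R' i)"

lemma in_basis_iff:
  "w \<in> basis B \<longleftrightarrow> w \<in> R0 \<or> (\<exists>i\<in>J. \<exists>r\<in>R i. \<exists>b\<in>B. \<exists>r'\<in>R' i. w = r @ b @ r')"
  unfolding basis_def lang_prod_def by auto

lemma frames_sublistD:
  assumes "u \<in> R0 \<union> (\<Union>i\<in>J. R i \<union> R' i)" "v \<in> R0 \<union> (\<Union>i\<in>J. R i \<union> R' i)" "sublist u v"
  shows "u = v"
  using antichain_frames assms unfolding antichain_def by blast

text \<open>The blocks have to match, as the letters around them are from \<open>X\<close>. Then \<open>r\<close> is a suffix of \<open>s\<close> and \<open>r'\<close> a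
  prefix of \<open>s'\<close>, and the frames are an antichain.\<close>

lemma framed_sublistD:
  assumes B: "B \<subseteq> lists Y - {[]}"
    and "i \<in> J" "r \<in> R i" "l \<in> B" "r' \<in> R' i"
    and "j \<in> J" "s \<in> R j" "m \<in> B" "s' \<in> R' j"
    and sub: "sublist (r @ l @ r') (s @ m @ s')"
  shows "r @ l @ r' = s @ m @ s'"
proof -
  obtain p q where "s @ m @ s' = p @ (r @ l @ r') @ q" using sub unfolding sublist_def by blast
  then have "(p @ r) @ l @ (r' @ q) = s @ m @ s'" by simp
  moreover have "l \<in> lists Y - {[]}" "s \<in> lists X" "s' \<in> lists X"
    using B assms R[OF \<open>j \<in> J\<close>] R'[OF \<open>j \<in> J\<close>] by auto
  ultimately obtain u v where uv: "p @ r = s @ u" "r' @ q = v @ s'" "m = u @ l @ v"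
    using factor_between[OF XY] by blast
  have m: "m \<in> lists Y" using B assms by auto
  have r: "r \<in> lists X" "r \<noteq> []" "r' \<in> lists X" "r' \<noteq> []"
    using R[OF \<open>i \<in> J\<close>] R'[OF \<open>i \<in> J\<close>] assms by auto
  have "u = []"
  proof (rule ccontr)
    assume "u \<noteq> []"
    then have "last u = last r" using arg_cong[OF uv(1), of last] r(2) by simp
    moreover have "last u \<in> Y" "last r \<in> X"
      using \<open>u \<noteq> []\<close> m uv(3) r(1,2) by (auto simp: in_lists_conv_set)
    ultimately show False using XY by auto
  qed
  moreover have "v = []"
  proof (rule ccontr)
    assume "v \<noteq> []"
    then have "hd v = hd r'" using arg_cong[OF uv(2), of hd] r(4) by simp
    moreover have "hd v \<in> Y" "hd r' \<in> X"
      using \<open>v \<noteq> []\<close> m uv(3) r(3,4) by (auto simp: in_lists_conv_set)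
    ultimately show False using XY by auto
  qed
  ultimately have e: "p @ r = s" "r' @ q = s'" "m = l" using uv by auto
  have "sublist r s" "sublist r' s'" using e by auto
  then have "r = s" "r' = s'" using frames_sublistD assms by blast+
  then show ?thesis using e by simp
qed

text \<open>A word of \<open>R0\<close> cannot be a subword of \<open>s m s'\<close>: it would be a subword of the frame \<open>s\<close> or \<open>s'\<close>,
  hence equal to it, against disjointness.\<close>

lemma antichain_basis:
  assumes B: "B \<subseteq> lists Y - {[]}"
  shows "antichain (basis B)"
  unfolding antichain_def
proof (intro ballI impI)
  fix u v assume u: "u \<in> basis B" and v: "v \<in> basis B" and sub: "sublist u v"
  consider "u \<in> R0" "v \<in> R0"
    | j s m s' where "u \<in> R0" "j \<in> J" "s \<in> R j" "m \<in> B" "s' \<in> R' j" "v = s @ m @ s'"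
    | i r l r' where "i \<in> J" "r \<in> R i" "l \<in> B" "r' \<in> R' i" "u = r @ l @ r'" "v \<in> R0"
    | i r l r' j s m s' where "i \<in> J" "r \<in> R i" "l \<in> B" "r' \<in> R' i" "u = r @ l @ r'"
        "j \<in> J" "s \<in> R j" "m \<in> B" "s' \<in> R' j" "v = s @ m @ s'"
    using u v unfolding in_basis_iff by blast
  then show "u = v"
  proof cases
    case 1
    then show ?thesis using frames_sublistD sub by blast
  next
    case 2
    have "u \<in> lists X" "u \<noteq> []" "m \<in> lists Y - {[]}" using 2 R0 B by auto
    then have "sublist u s \<or> sublist u s'" using sublist_between[OF XY] sub 2 by blast
    then have "u = s \<or> u = s'" using frames_sublistD[of u] 2 by blast
    then show ?thesis using 2 R0_disjoint by blast
  next
    case 3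
    then have "set l \<subseteq> X" using set_mono_sublist[OF sub] R0 by auto
    moreover have "l \<noteq> []" "set l \<subseteq> Y" using 3 B by auto
    ultimately show ?thesis using XY by (cases l) auto
  next
    case 4
    then show ?thesis using framed_sublistD[OF B] sub by blast
  qed
qed

lemma basis_subset_lists:
  assumes "B \<subseteq> lists Y"
  shows "basis B \<subseteq> lists (X \<union> Y)"
proof
  have mono: "lists X \<subseteq> lists (X \<union> Y)" "lists Y \<subseteq> lists (X \<union> Y)" by (simp_all add: lists_mono)
  fix w assume "w \<in> basis B"
  then consider "w \<in> R0" | i r b r' where "i \<in> J" "r \<in> R i" "b \<in> B" "r' \<in> R' i" "w = r @ b @ r'"
    unfolding in_basis_iff by blast
  then show "w \<in> lists (X \<union> Y)"
  proof cases
    case 1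
    then show ?thesis using R0 mono by blast
  next
    case 2
    then have "r \<in> lists (X \<union> Y)" "b \<in> lists (X \<union> Y)" "r' \<in> lists (X \<union> Y)"
      using R R' assms mono by blast+
    then show ?thesis using 2 by simp
  qed
qed

lemma basis_ends:
  assumes "B \<subseteq> lists Y - {[]}" "w \<in> basis B"
  shows "w \<noteq> [] \<and> hd w \<in> X \<and> last w \<in> X"
proof -
  have "u \<noteq> [] \<and> hd u \<in> X \<and> last u \<in> X" if "u \<in> lists X - {[]}" for u
    using that by (auto simp: in_lists_conv_set)
  then show ?thesis using assms(2) R0 R R' unfolding in_basis_iff by fastforce
qed

lemma block_invariant_basis: "block_invariant Y (basis (lists Y - {[]}))"
  unfolding block_invariant_def
proof (intro ballI allI impI)
  fix l l' u w
  assume l: "l \<in> lists Y - {[]}" "l' \<in> lists Y - {[]}" and w: "u @ l @ w \<in> basis (lists Y - {[]})"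
  have "u @ l @ w \<notin> R0"
  proof
    assume "u @ l @ w \<in> R0"
    then have "set l \<subseteq> X" using R0 by auto
    then show False using l(1) XY by (cases l) auto
  qed
  then obtain i r m r' where i: "i \<in> J" "r \<in> R i" "m \<in> lists Y - {[]}" "r' \<in> R' i"
    "u @ l @ w = r @ m @ r'" using w unfolding in_basis_iff by blast
  have "r \<in> lists X" "r' \<in> lists X" using i R R' by blast+
  then obtain a b where "u = r @ a" "w = b @ r'" "m = a @ l @ b"
    using factor_between[OF XY l(1) _ _ i(5)] by blast
  then have "u @ l' @ w = r @ (a @ l' @ b) @ r'" "a @ l' @ b \<in> lists Y - {[]}" using l(2) i(3) by auto
  then show "u @ l' @ w \<in> basis (lists Y - {[]})" unfolding in_basis_iff using i by blast
qed

lemma basis_eq_Int_blocks: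
  assumes L: "L \<subseteq> lists Y - {[]}"
  shows "basis L = basis (lists Y - {[]}) \<inter> blocks X L"
proof -
  have X_blocks: "u @ w \<in> blocks X L \<longleftrightarrow> w \<in> blocks X L" if "u \<in> lists X" for u w
    using that by (induction u) (auto simp: blocks_letter_iff[OF XY L])
  have R0_blocks: "R0 \<subseteq> blocks X L"
    using X_blocks[of _ "[]"] R0 by (auto intro: blocks_Nil)
  have framed_blocks: "r @ b @ r' \<in> blocks X L \<longleftrightarrow> b \<in> L"
    if i: "i \<in> J" "r \<in> R i" "b \<in> lists Y - {[]}" "r' \<in> R' i" for i r b r'
  proof -
    have "r \<in> lists X" using R i by blast
    moreover have "r' \<in> lists X - {[]}" using R' i by blast
    then obtain x z where z: "r' = x # z" "x \<in> X" "z \<in> lists X" by (cases r') auto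
    moreover have "z \<in> blocks X L" using X_blocks[OF z(3), of "[]"] by (simp add: blocks_Nil)
    ultimately show ?thesis using X_blocks blocks_block_iff[OF XY L i(3)] by simp
  qed
  show ?thesis
  proof (intro equalityI subsetI IntI)
    fix w assume "w \<in> basis L"
    then consider "w \<in> R0" | i r b r' where "i \<in> J" "r \<in> R i" "b \<in> L" "r' \<in> R' i" "w = r @ b @ r'"
      unfolding in_basis_iff by blast
    then have "w \<in> basis (lists Y - {[]}) \<and> w \<in> blocks X L"
    proof cases
      case 1
      then show ?thesis using R0_blocks unfolding in_basis_iff by blast
    next
      case 2
      moreover from this have "b \<in> lists Y - {[]}" using L by blast
      ultimately show ?thesis using framed_blocks unfolding in_basis_iff by blast
    qed
    then show "w \<in> basis (lists Y - {[]})" "w \<in> blocks X L" by simp_all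
  next
    fix w assume w: "w \<in> basis (lists Y - {[]}) \<inter> blocks X L"
    then consider "w \<in> R0"
      | i r b r' where "i \<in> J" "r \<in> R i" "b \<in> lists Y - {[]}" "r' \<in> R' i" "w = r @ b @ r'"
      unfolding Int_iff in_basis_iff by blast
    then show "w \<in> basis L"
    proof cases
      case 2
      then have "b \<in> L" using framed_blocks w by blast
      then show ?thesis using 2 unfolding in_basis_iff by blast
    qed (simp add: in_basis_iff)
  qed
qed

lemma unambiguous_cfl_chain_words_basis:
  assumes "finite X" "finite J" and L: "L \<subseteq> lists Y - {[]}" "unambiguous_cfl L"
    and reg: "regular_lang X R0" "\<And>i. i \<in> J \<Longrightarrow> regular_lang X (R i) \<and> regular_lang X (R' i)"
  shows "unambiguous_cfl (chain_words (basis L) n)"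
proof -
  let ?M = "basis (lists Y - {[]})"
  have ends: "\<And>w. w \<in> ?M \<Longrightarrow> w \<noteq> [] \<and> hd w \<in> X \<and> last w \<in> X" using basis_ends by blast
  have M: "antichain ?M" "[] \<notin> ?M" using antichain_basis ends by blast+
  have "finite_index ?M"
    unfolding basis_def
    by (intro finite_index_Un finite_index_UN finite_index_lang_prod finite_index_lists)
      (use \<open>finite J\<close> reg finite_index_regular_lang in auto)
  then have "finite_index (chain_words ?M n)" by (rule finite_index_chain_words[OF M])
  moreover have "block_invariant Y (chain_words ?M n)"
    by (rule block_invariant_chain_words[OF M block_invariant_basis]) (use ends XY in blast)
  ultimately have "unambiguous_cfl (chain_words ?M n \<inter> blocks X L)"
    by (rule unambiguous_cfl_blocks[OF \<open>finite X\<close> XY L])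
  moreover have "chain_words (basis L) n = chain_words ?M n \<inter> blocks X L"
    unfolding basis_eq_Int_blocks[OF L(1)] by (rule chain_words_Int_blocks[OF XY L(1) ends])
  ultimately show ?thesis by simp
qed

end

theorem theorem6p4:
  fixes X Y :: "'a set"
    and L R0 L1 :: "'a list set"
    and R R' :: "nat \<Rightarrow> 'a list set"
    and k :: nat
    and I :: "('a list \<Rightarrow>\<^sub>0 'k::field) set"
    and A :: "('a list \<Rightarrow>\<^sub>0 'k) set ring"
  assumes "finite X" and "finite Y" and "X \<inter> Y = {}"
    and "L \<subseteq> lists Y - {[]}" and "unambiguous_cfl L"
    and "k \<ge> 1"
    and "R0 \<subseteq> lists X" and "regular_lang X R0"
    and "\<And>i. i \<in> {1..k} \<Longrightarrow> R i \<subseteq> lists X - {[]} \<and> regular_lang X (R i)"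
    and "\<And>i. i \<in> {1..k} \<Longrightarrow> R' i \<subseteq> lists X - {[]} \<and> regular_lang X (R' i)"
    and disjoint:
      "\<And>i. i \<in> {1..k} \<Longrightarrow> R0 \<inter> R i = {} \<and> R0 \<inter> R' i = {}"
      "\<And>i j. i \<in> {1..k} \<Longrightarrow> j \<in> {1..k} \<Longrightarrow> R i \<inter> R' j = {}"
      "\<And>i j. i \<in> {1..k} \<Longrightarrow> j \<in> {1..k} \<Longrightarrow> i \<noteq> j \<Longrightarrow> R i \<inter> R j = {} \<and> R' i \<inter> R' j = {}"
    and "antichain (R0 \<union> (\<Union>i\<in>{1..k}. R i \<union> R' i))"
    and "L1 = R0 \<union> (\<Union>i\<in>{1..k}. R i \<cdot>\<cdot> L \<cdot>\<cdot> R' i)"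
    and "\<And>w. w \<in> L1 \<Longrightarrow> length w \<ge> 2"
    and "I = monomial_ideal_gen (X \<union> Y) L1"
    and "A = free_algebra (X \<union> Y) Quot I"
  shows "homologically_unambiguous (X \<union> Y) A"
proof -
  have "[] \<notin> R0" using assms(15,16) by fastforce
  then interpret framed_basis X Y "{1..k}" R0 R R'
    by unfold_locales (use assms(3,7,9,10) disjoint assms(14) in auto)
  have L1: "L1 = basis L" using assms(15) unfolding basis_def .
  have L1_lists: "L1 \<subseteq> lists (X \<union> Y)" unfolding L1 by (rule basis_subset_lists) (use assms(4) in blast)
  then have min_basis: "min_basis (X \<union> Y) I = L1"
    unfolding \<open>I = monomial_ideal_gen (X \<union> Y) L1\<close>
    by (rule min_basis_monomial_ideal_gen) (use L1 antichain_basis[OF \<open>L \<subseteq> lists Y - {[]}\<close>] in simp)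
  have "unambiguous_cfl (chain_lang (X \<union> Y) I i)" if "i \<ge> 1" for i
  proof -
    from that obtain n where "i = Suc n" by (cases i) auto
    then have "chain_lang (X \<union> Y) I i = chain_words (basis L) n"
      by (simp add: chain_lang_def min_basis L1 chain_words_def)
    moreover have "unambiguous_cfl (chain_words (basis L) n)"
      by (rule unambiguous_cfl_chain_words_basis) (use assms(1,4,5,8-10) in auto)
    ultimately show ?thesis by simp
  qed
  moreover have "monomial_ideal (X \<union> Y) I"
    unfolding monomial_ideal_def using L1_lists assms(17) by blast
  ultimately show ?thesis
    unfolding homologically_unambiguous_def using min_basis assms(16,18) by auto
qed

end
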